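(* For the special Askey-Wilson parameters $(a,b,c,d)=\bigl(0,\frac1{2\tau},1,1-\frac1{2\tau}\bigr)$ the Askey-Wilson function $\mathfrak{E}^+$ is given by $$\mathfrak{E}^+\bigl(\mu,x;0,\tfrac1{2\tau},1,1-\tfrac1{2\tau}\bigr)=\frac{\bigl(-q,-q;q^2\bigr)_\infty}{2}\left(\frac{\vartheta(\mu+x)+\vartheta(\mu-x)}{\vartheta(\mu)\,\vartheta(x)}\right)$$ as meromorphic functions of $(\mu,x)\in\mathbb{C}\times\mathbb{C}$, where $\vartheta(x)=\bigl(-q^{1+x},-q^{1-x};q^2\bigr)_\infty$.
   Context: Here $\tau\in i\mathbb{R}_{>0}$, $q=\exp(2\pi i\tau)\in(0,1)$, $q^u=\exp(2\pi i\tau u)$ for $u\in\mathbb{C}$ (so $q^{1/(2\tau)}=-1$). For $n\in\mathbb{Z}_{\ge0}\cup\{\infty\}$: $(b;q)_n=\prod_{j=0}^{n-1}(1-bq^j)$ and $(b_1,\dots,b_m;q)_n=\prod_{j=1}^m(b_j;q)_n$ (similarly with base $q^2$). The very-well-poised series is, for $|z|<1$, $${}_8W_7(u;b_1,\dots,b_5;q,z)=\sum_{k=0}^\infty\frac{(1-uq^{2k})\,(u,b_1,b_2,b_3,b_4,b_5;q)_k\,z^k}{(1-u)\,(q,qu/b_1,qu/b_2,qu/b_3,qu/b_4,qu/b_5;q)_k},$$ used below with base $q^2$ (i.e. $q$ replaced by $q^2$ throughout). For Askey-Wilson parameters $(a,b,c,d)$ the dual parameters are $$(\widetilde a,\widetilde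 b,\widetilde c,\widetilde d)=\bigl(-1+\tfrac12(a+b+c+d),\;1+\tfrac12(a+b-c-d),\;1+\tfrac12(a-b+c-d),\;1+\tfrac12(a-b-c+d)\bigr).$$ The Askey-Wilson function is defined, for $|q^{2-\widetilde d-\mu}|<1$, by $$\mathfrak{E}^+(\mu,x;a,b,c,d)=\frac{\bigl(q^{2+a-\widetilde d+\mu+x},q^{2+a-\widetilde d+\mu-x},q^{2-a-d},q^{2+a-d};q^2\bigr)_\infty}{\bigl(q^{\widetilde a+\widetilde b+\widetilde c+\mu},q^{2-\widetilde d+\mu},q^{2-d+x},q^{2-d-x};q^2\bigr)_\infty}\;{}_8W_7\bigl(q^{-2+\widetilde a+\widetilde b+\widetilde c+\mu};q^{a+x},q^{a-x},q^{\widetilde a+\mu},q^{\widetilde b+\mu},q^{\widetilde c+\mu};q^2,q^{2-\widetilde d-\mu}\bigr),$$ and for all $(\mu,x)\in\mathbb{C}\times\mathbb{C}$ by meromorphic continuation. (The special parameters in the claim are self-dual: $(\widetilde a,\widetilde b,\widetilde c,\widetilde d)=(a,b,c,d)$.) *)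

theory Defs
  imports "HOL-Analysis.Analysis"
begin

section \<open>Meromorphic functions of two complex variables\<close>

text \<open>The derivative is required to be complex linear. The notion is only meant for open sets.\<close>

definition holomorphic2_on :: "(complex \<times> complex \<Rightarrow> complex) \<Rightarrow> (complex \<times> complex) set \<Rightarrow> bool"
  where "holomorphic2_on f U \<longleftrightarrow>
    (\<forall>z\<in>U. \<exists>a b. (f has_derivative (\<lambda>(v, w). a * v + b * w)) (at z))"

text \<open>
  A meromorphic function is represented by a total function that is locally a quotient of
  holomorphic functions, the denominator vanishing identically on no nonempty open subset.
  The values at the zeros of the local denominators are irrelevant; accordingly
  equality of meromorphic functions is equality on a dense open set.
\<close>

definition meromorphic2 :: "(complex \<times> complex \<Rightarrow> complex) \<Rightarrow> bool"
  where "meromorphic2 f \<longleftrightarrow>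
    (\<forall>z0. \<exists>U g h. open U \<and> z0 \<in> U \<and> holomorphic2_on g U \<and> holomorphic2_on h U \<and>
       U \<subseteq> closure {z \<in> U. h z \<noteq> 0} \<and> (\<forall>z\<in>U. h z \<noteq> 0 \<longrightarrow> f z = g z / h z))"

definition meromorphic2_eq ::
  "(complex \<times> complex \<Rightarrow> complex) \<Rightarrow> (complex \<times> complex \<Rightarrow> complex) \<Rightarrow> bool"
  where "meromorphic2_eq f g \<longleftrightarrow> meromorphic2 f \<and> meromorphic2 g \<and>
    (\<exists>D. open D \<and> closure D = UNIV \<and> (\<forall>z\<in>D. f z = g z))"

definition meromorphic2_continuation ::
  "(complex \<times> complex \<Rightarrow> complex) \<Rightarrow> (complex \<times> complex) set \<Rightarrow> (complex \<times> complex \<Rightarrow> complex) \<Rightarrow> bool"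
  where "meromorphic2_continuation f U F \<longleftrightarrow> meromorphic2 F \<and> (\<forall>z\<in>U. F z = f z)"


section \<open>Basic hypergeometric notation\<close>

text \<open>
  Powers of $q = \exp(2\pi i\tau)$ depend on $\tau$, not just on $q$: in particular
  $q^{1/(2\tau)} = -1$.
\<close>

definition qpow :: "complex \<Rightarrow> complex \<Rightarrow> complex"
  where "qpow \<tau> u = exp (2 * of_real pi * \<i> * \<tau> * u)"

definition qpoch :: "complex list \<Rightarrow> complex \<Rightarrow> nat \<Rightarrow> complex"
  where "qpoch bs p n = (\<Prod>b\<leftarrow>bs. \<Prod>j<n. 1 - b * p ^ j)"

definition qpoch_inf :: "complex list \<Rightarrow> complex \<Rightarrow> complex"
  where "qpoch_inf bs p = (\<Prod>b\<leftarrow>bs. \<Prod>j. 1 - b * p ^ j)"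

definition W87 :: "complex \<Rightarrow> complex \<Rightarrow> complex \<Rightarrow> complex \<Rightarrow> complex \<Rightarrow> complex \<Rightarrow> complex \<Rightarrow> complex \<Rightarrow> complex"
  where "W87 u b1 b2 b3 b4 b5 p z =
    (\<Sum>k. ((1 - u * p ^ (2 * k)) * qpoch [u, b1, b2, b3, b4, b5] p k * z ^ k) /
          ((1 - u) * qpoch [p, p * u / b1, p * u / b2, p * u / b3, p * u / b4, p * u / b5] p k))"

text \<open>No denominator in the series \<^term>\<open>W87\<close> vanishes.\<close>

definition W87_regular :: "complex \<Rightarrow> complex \<Rightarrow> complex \<Rightarrow> complex \<Rightarrow> complex \<Rightarrow> complex \<Rightarrow> complex \<Rightarrow> bool"
  where "W87_regular u b1 b2 b3 b4 b5 p \<longleftrightarrow>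
    u \<noteq> 1 \<and> (\<forall>k. qpoch [p, p * u / b1, p * u / b2, p * u / b3, p * u / b4, p * u / b5] p k \<noteq> 0)"


section \<open>The Askey-Wilson function\<close>

definition dual_a :: "complex \<Rightarrow> complex \<Rightarrow> complex \<Rightarrow> complex \<Rightarrow> complex"
  where "dual_a a b c d = - 1 + (a + b + c + d) / 2"

definition dual_b :: "complex \<Rightarrow> complex \<Rightarrow> complex \<Rightarrow> complex \<Rightarrow> complex"
  where "dual_b a b c d = 1 + (a + b - c - d) / 2"

definition dual_c :: "complex \<Rightarrow> complex \<Rightarrow> complex \<Rightarrow> complex \<Rightarrow> complex"
  where "dual_c a b c d = 1 + (a - b + c - d) / 2"

definition dual_d :: "complex \<Rightarrow> complex \<Rightarrow> complex \<Rightarrow> complex \<Rightarrow> complex"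
  where "dual_d a b c d = 1 + (a - b - c + d) / 2"

definition AW_series ::
  "complex \<Rightarrow> complex \<Rightarrow> complex \<Rightarrow> complex \<Rightarrow> complex \<Rightarrow> complex \<times> complex \<Rightarrow> complex"
  where "AW_series \<tau> a b c d = (\<lambda>(\<mu>, x).
    let a' = dual_a a b c d; b' = dual_b a b c d; c' = dual_c a b c d; d' = dual_d a b c d in
    qpoch_inf [qpow \<tau> (2 + a - d' + \<mu> + x), qpow \<tau> (2 + a - d' + \<mu> - x),
               qpow \<tau> (2 - a - d), qpow \<tau> (2 + a - d)] (qpow \<tau> 2) /
    qpoch_inf [qpow \<tau> (a' + b' + c' + \<mu>), qpow \<tau> (2 - d' + \<mu>),
               qpow \<tau> (2 - d + x), qpow \<tau> (2 - d - x)] (qpow \<tau> 2) *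
    W87 (qpow \<tau> (- 2 + a' + b' + c' + \<mu>)) (qpow \<tau> (a + x)) (qpow \<tau> (a - x))
        (qpow \<tau> (a' + \<mu>)) (qpow \<tau> (b' + \<mu>)) (qpow \<tau> (c' + \<mu>))
        (qpow \<tau> 2) (qpow \<tau> (2 - d' - \<mu>)))"

text \<open>
  The points at which the defining formula is meaningful: the argument of the series has
  modulus less than 1 and no denominator vanishes.
\<close>

definition AW_domain ::
  "complex \<Rightarrow> complex \<Rightarrow> complex \<Rightarrow> complex \<Rightarrow> complex \<Rightarrow> (complex \<times> complex) set"
  where "AW_domain \<tau> a b c d = {(\<mu>, x).
    let a' = dual_a a b c d; b' = dual_b a b c d; c' = dual_c a b c d; d' = dual_d a b c d in
    norm (qpow \<tau> (2 - d' - \<mu>)) < 1 \<and>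
    qpoch_inf [qpow \<tau> (a' + b' + c' + \<mu>), qpow \<tau> (2 - d' + \<mu>),
               qpow \<tau> (2 - d + x), qpow \<tau> (2 - d - x)] (qpow \<tau> 2) \<noteq> 0 \<and>
    W87_regular (qpow \<tau> (- 2 + a' + b' + c' + \<mu>)) (qpow \<tau> (a + x)) (qpow \<tau> (a - x))
        (qpow \<tau> (a' + \<mu>)) (qpow \<tau> (b' + \<mu>)) (qpow \<tau> (c' + \<mu>)) (qpow \<tau> 2)}"

text \<open>
  The meromorphic continuation is determined up to \<^const>\<open>meromorphic2_eq\<close> as soon as the
  domain above is nonempty; the choice only fixes a representing total function.
\<close>

definition askey_wilson ::
  "complex \<Rightarrow> complex \<Rightarrow> complex \<Rightarrow> complex \<Rightarrow> complex \<Rightarrow> complex \<times> complex \<Rightarrow> complex"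
  where "askey_wilson \<tau> a b c d =
    (SOME F. meromorphic2_continuation (AW_series \<tau> a b c d) (AW_domain \<tau> a b c d) F)"

definition vtheta :: "complex \<Rightarrow> complex \<Rightarrow> complex"
  where "vtheta \<tau> x = qpoch_inf [- qpow \<tau> (1 + x), - qpow \<tau> (1 - x)] (qpow \<tau> 2)"

end

theory Submission
  imports Defs "HOL-Complex_Analysis.Complex_Analysis"
begin

text \<open>
  Put \<open>m = q\<^sup>\<mu>\<close> and \<open>X = q\<^sup>x\<close>. The series, multiplied by
  \<open>(-q m X, -q m / X; q\<^sup>2)\<^sub>\<infinity>\<close>, is a symmetric holomorphic function \<open>G\<close> of \<open>X \<noteq> 0\<close>, and a
  telescoping argument shows that it satisfies
  \<open>q X G(q\<^sup>2 X) + (q / X) G(X / q\<^sup>2) = (m + 1/m) G(X)\<close>.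
  So does \<open>\<vartheta>(\<mu> + x) + \<vartheta>(\<mu> - x)\<close>. The equation is a three-term recurrence for the Laurent
  coefficients, so its symmetric solutions form a one-dimensional space, and \<open>X = 1\<close>
  (where the series reduces to its first term) determines the factor. This gives the identity
  wherever the series is defined, and the identity theorem carries it over to every
  meromorphic continuation.
\<close>

section \<open>Fourier coefficients of periodic entire functions\<close>

text \<open>At these parameters \<open>q^a, q^b, q^c, q^d\<close> are \<open>1, -1, q, -q\<close>.
  In base \<open>q^2\<close> the coefficient of the Askey-Wilson difference operator is then
  \<open>(1 - X) (1 + X) (1 - q X) (1 + q X) / ((1 - X^2) (1 - q^2 X^2)) = 1\<close>, so the
  Askey-Wilson function \<open>f\<close> satisfies an equation with constant coefficients,
  \<open>f (q^2 X) + f (X / q^2) = (m + 1/m) f X\<close>. By itself this determines little: a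
  solution can be multiplied by any function of \<open>X\<close> invariant under
  \<open>X -> q^2 X\<close>. The poles of \<open>f\<close> in \<open>X\<close> decide the matter. Up
  to a factor free of \<open>X\<close>, the function \<open>G\<close> is \<open>f\<close> times
  \<vartheta>(x), and the quasi-periodicity of \<vartheta> turns the two constant coefficients into
  the monomials \<open>q X\<close> and \<open>q / X\<close>. Being holomorphic for \<open>X\<close>
  nonzero, \<open>G\<close> has a Laurent series, on which these monomials act by shifting the
  index. Throughout this argument \<open>m\<close> is a fixed number with \<open>|q| < |m|\<close>;
  the second variable enters only when the identity is carried over to the continuation.\<close>

text \<open>
  The Laurent coefficients of \<open>G\<close> appear as the Fourier coefficients of \<open>H z = G (exp z)\<close>: the
  coefficient is the increment over a period of a primitive of \<open>H z * exp (- n z)\<close>.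
  It is only meaningful for entire \<open>H\<close> with period \<open>2 \<pi> \<i>\<close>, and is not divided by \<open>2 \<pi> \<i>\<close>.
\<close>

definition fourier_coeff :: "(complex \<Rightarrow> complex) \<Rightarrow> int \<Rightarrow> complex"
  where "fourier_coeff H n =
    (let F = (SOME F. \<forall>z. (F has_field_derivative H z * exp (- of_int n * z)) (at z))
     in F (2 * of_real pi * \<i>) - F 0)"

lemma entire_primitive:
  assumes "f holomorphic_on UNIV"
  obtains F where "\<And>z::complex. (F has_field_derivative f z) (at z)"
  using holomorphic_convex_primitive'[of UNIV f] assms by auto

lemma derivative_zero_constant:
  assumes "\<And>z::complex. (F has_field_derivative 0) (at z)"
  shows "F z = F w"
  using has_field_derivative_zero_constant[of UNIV F] assms by (metis UNIV_I convex_UNIV)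

lemma exp_period: "exp (z + 2 * of_real pi * \<i>) = exp (z::complex)"
  by (simp add: exp_add)

lemma exp_int_period: "exp (of_int n * (z + 2 * of_real pi * \<i>)) = exp (of_int n * (z::complex))"
proof -
  have "exp (of_int n * (z + 2 * of_real pi * \<i>)) = exp (of_int n * z) * exp (of_int (2 * n) * (of_real pi * \<i>))"
    by (simp add: exp_add[symmetric] algebra_simps)
  also have "exp (of_int (2 * n) * (of_real pi * \<i>)) = 1"
    using exp_integer_2pi[of "of_int n"] by (simp add: algebra_simps)
  finally show ?thesis by simp
qed

text \<open>Two primitives differ by a constant, and the increment over a period has derivative zero
  in its starting point because the integrand is periodic. The free base point \<open>w\<close>
  replaces a shift of contour in the lemmas below.\<close>

lemma fourier_coeff_eq:
  assumes per: "\<And>z. H (z + 2 * of_real pi * \<i>) = H z"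
    and F: "\<And>z. (F has_field_derivative H z * exp (- of_int n * z)) (at z)"
  shows "fourier_coeff H n = F (w + 2 * of_real pi * \<i>) - F w"
proof -
  define K where "K = (SOME F. \<forall>z. (F has_field_derivative H z * exp (- of_int n * z)) (at z))"
  have "\<exists>F. \<forall>z. (F has_field_derivative H z * exp (- of_int n * z)) (at z)"
    using F by blast
  then have K: "\<And>z. (K has_field_derivative H z * exp (- of_int n * z)) (at z)"
    unfolding K_def by (rule someI2_ex) blast
  have "((\<lambda>z. K z - F z) has_field_derivative 0) (at z)" for z
    using DERIV_diff[OF K F, of z] by simp
  then have KF: "K z - F z = K 0 - F 0" for z
    by (rule derivative_zero_constant)
  have "((\<lambda>z. F (z + 2 * of_real pi * \<i>) - F z) has_field_derivative 0) (at z)" for z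
  proof -
    have e: "exp (- of_int n * (z + 2 * of_real pi * \<i>)) = exp (- of_int n * z)"
      using exp_int_period[of "- n" z] by simp
    have "((\<lambda>z. F (z + 2 * of_real pi * \<i>)) has_field_derivative H z * exp (- of_int n * z)) (at z)"
      using F[of "z + 2 * of_real pi * \<i>"] unfolding per e by (simp add: DERIV_shift)
    from DERIV_diff[OF this F] show ?thesis by simp
  qed
  then have "F (w + 2 * of_real pi * \<i>) - F w = F (0 + 2 * of_real pi * \<i>) - F 0"
    by (rule derivative_zero_constant)
  also have "\<dots> = K (2 * of_real pi * \<i>) - K 0"
    using KF[of "2 * of_real pi * \<i>"] by (simp add: algebra_simps)
  finally show ?thesis
    unfolding fourier_coeff_def K_def[symmetric] Let_def by simp
qed

lemma fourier_coeff_primitive: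
  assumes "H holomorphic_on UNIV"
  obtains F where "\<And>z. (F has_field_derivative H z * exp (- of_int n * z)) (at z)"
  by (rule entire_primitive[of "\<lambda>z. H z * exp (- of_int n * z)"])
    (use assms in \<open>auto intro!: holomorphic_intros\<close>)

lemma fourier_coeff_linear:
  assumes "H holomorphic_on UNIV" "K holomorphic_on UNIV"
    and perH: "\<And>z. H (z + 2 * of_real pi * \<i>) = H z"
    and perK: "\<And>z. K (z + 2 * of_real pi * \<i>) = K z"
  shows "fourier_coeff (\<lambda>z. a * H z + b * K z) n = a * fourier_coeff H n + b * fourier_coeff K n"
proof -
  obtain F where F: "\<And>z. (F has_field_derivative H z * exp (- of_int n * z)) (at z)"
    using fourier_coeff_primitive assms(1) by blast
  obtain L where L: "\<And>z. (L has_field_derivative K z * exp (- of_int n * z)) (at z)"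
    using fourier_coeff_primitive assms(2) by blast
  have "((\<lambda>z. a * F z + b * L z) has_field_derivative (a * H z + b * K z) * exp (- of_int n * z)) (at z)" for z
    by (rule derivative_eq_intros F L refl)+ (simp add: algebra_simps)
  from fourier_coeff_eq[OF _ this, of 0]
  have "fourier_coeff (\<lambda>z. a * H z + b * K z) n
      = a * F (0 + 2 * of_real pi * \<i>) + b * L (0 + 2 * of_real pi * \<i>) - (a * F 0 + b * L 0)"
    by (simp add: perH perK)
  then show ?thesis
    unfolding fourier_coeff_eq[where H = H, OF perH F, of 0] fourier_coeff_eq[where H = K, OF perK L, of 0]
    by (simp only: algebra_simps)
qed

text \<open>The substitution \<open>z + c\<close> turns a primitive for \<open>H\<close> at index
  \<open>n - k\<close> into one for the new function at index \<open>n\<close>, up to a constant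
  factor. The increment from 0 becomes one from \<open>c\<close>, which is harmless as the base
  point is free.\<close>

lemma fourier_coeff_shift:
  assumes "H holomorphic_on UNIV"
    and per: "\<And>z. H (z + 2 * of_real pi * \<i>) = H z"
  shows "fourier_coeff (\<lambda>z. exp (of_int k * z) * H (z + c)) n
    = exp (of_int (n - k) * c) * fourier_coeff H (n - k)"
proof -
  obtain F where F: "\<And>z. (F has_field_derivative H z * exp (- of_int (n - k) * z)) (at z)"
    using fourier_coeff_primitive assms(1) by blast
  have D: "((\<lambda>z. exp (of_int (n - k) * c) * F (z + c)) has_field_derivative
      (exp (of_int k * z) * H (z + c)) * exp (- of_int n * z)) (at z)" for z
  proof -
    have "((\<lambda>z. F (z + c)) has_field_derivative H (z + c) * exp (- of_int (n - k) * (z + c))) (at z)"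
      using F[of "z + c"] by (simp add: DERIV_shift)
    from DERIV_cmult[OF this, of "exp (of_int (n - k) * c)"] show ?thesis
      by (rule DERIV_cong) (simp add: mult_exp_exp algebra_simps)
  qed
  have "exp (of_int k * (z + 2 * of_real pi * \<i>)) * H (z + 2 * of_real pi * \<i> + c)
      = exp (of_int k * z) * H (z + c)" for z
    using per[of "z + c"] unfolding exp_int_period by (simp add: add_ac)
  from fourier_coeff_eq[OF this D, of 0] show ?thesis
    unfolding fourier_coeff_eq[where H = H, OF per F, of c]
    by (simp add: right_diff_distrib add.commute)
qed

lemma fourier_coeff_reflect:
  assumes "H holomorphic_on UNIV"
    and per: "\<And>z. H (z + 2 * of_real pi * \<i>) = H z"
  shows "fourier_coeff (\<lambda>z. H (- z)) n = fourier_coeff H (- n)"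
proof -
  obtain F where F: "\<And>z. (F has_field_derivative H z * exp (- of_int (- n) * z)) (at z)"
    using fourier_coeff_primitive assms(1) by blast
  have D: "((\<lambda>z. - F (- z)) has_field_derivative H (- z) * exp (- of_int n * z)) (at z)" for z
    using DERIV_minus[OF DERIV_chain2[OF F, where g = uminus and x = z and Db = "-1" and s = UNIV]]
    by (simp add: DERIV_minus DERIV_ident)
  have "H (- (z + 2 * of_real pi * \<i>)) = H (- z)" for z
    using per[of "- (z + 2 * of_real pi * \<i>)"] by simp
  from fourier_coeff_eq[OF this D, of 0] fourier_coeff_eq[where H = H, OF per F, of "- (2 * of_real pi * \<i>)"]
  show ?thesis by simp
qed

lemma fourier_coeff_const:
  "fourier_coeff (\<lambda>_. c) n = (if n = 0 then 2 * of_real pi * \<i> * c else 0)"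
proof (cases "n = 0")
  case True
  have "((\<lambda>z. c * z) has_field_derivative c * exp (- of_int n * z)) (at z)" for z
    by (rule derivative_eq_intros refl)+ (simp add: True)
  from fourier_coeff_eq[OF _ this, of 0] True show ?thesis by simp
next
  case False
  have "((\<lambda>z. - c / of_int n * exp (of_int (- n) * z)) has_field_derivative c * exp (- of_int n * z)) (at z)" for z
    by (rule derivative_eq_intros refl)+ (use False in simp)
  from fourier_coeff_eq[OF _ this, of 0] False show ?thesis
    using exp_int_period[of "-n" 0] by simp
qed

text \<open>Cauchy's estimate on the vertical segment over \<open>s\<close>, where the exponential
  has constant modulus \<open>exp (- n s)\<close>. One \<open>M\<close>, depending on
  \<open>s\<close>, serves all \<open>n\<close>, so growth rates for different \<open>s\<close> can
  be compared.\<close>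

lemma fourier_coeff_bound:
  assumes "H holomorphic_on UNIV"
    and per: "\<And>z. H (z + 2 * of_real pi * \<i>) = H z"
  obtains M where "\<And>n. norm (fourier_coeff H n) \<le> M * exp (- of_int n * s)"
proof -
  define w :: complex where "w = of_real s"
  define S where "S = closed_segment w (w + 2 * of_real pi * \<i>)"
  have "compact (H ` S)"
    unfolding S_def
    by (intro compact_continuous_image continuous_on_subset[OF holomorphic_on_imp_continuous_on[OF assms(1)]]) auto
  then obtain B where B: "\<And>z. z \<in> S \<Longrightarrow> norm (H z) \<le> B"
    using compact_imp_bounded bounded_iff by (metis image_eqI)
  have "norm (fourier_coeff H n) \<le> (B * (2 * pi)) * exp (- of_int n * s)" for n
  proof -
    obtain F where F: "\<And>z. (F has_field_derivative H z * exp (- of_int n * z)) (at z)"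
      using fourier_coeff_primitive assms(1) by blast
    have "norm (F (w + 2 * of_real pi * \<i>) - F w) \<le> (B * exp (- of_int n * s)) * norm (w + 2 * of_real pi * \<i> - w)"
    proof (rule field_differentiable_bound[where S = S and f = F and f' = "\<lambda>z. H z * exp (- of_int n * z)"])
      show "(F has_field_derivative H z * exp (- of_int n * z)) (at z within S)" for z
        using F by (rule has_field_derivative_at_within)
      show "norm (H z * exp (- of_int n * z)) \<le> B * exp (- of_int n * s)" if "z \<in> S" for z
      proof -
        have "Re z = s"
          using that by (auto simp: S_def w_def in_segment algebra_simps)
        then have "norm (exp (- of_int n * z)) = exp (- of_int n * s)"
          by simp
        then show ?thesis
          unfolding norm_mult using B[OF that] by (simp only: mult_right_mono exp_ge_zero)
      qed
    qed (auto simp: S_def)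
    then show ?thesis
      using fourier_coeff_eq[where H = H, OF per F, of w] by (simp add: norm_mult mult_ac)
  qed
  then show ?thesis by (rule that)
qed

lemma periodic_int:
  assumes per: "\<And>z::complex. H (z + 2 * of_real pi * \<i>) = H z"
  shows "H (z + 2 * of_int n * of_real pi * \<i>) = H z"
proof (induction n rule: int_induct[where k = 0])
  case (step1 i)
  then show ?case using per[of "z + 2 * of_int i * of_real pi * \<i>"] by (simp add: algebra_simps)
next
  case (step2 i)
  then show ?case using per[of "z + 2 * of_int (i - 1) * of_real pi * \<i>"] by (simp add: algebra_simps)
qed simp

lemma geometric_bound_nonpos:
  fixes x C :: real
  assumes "\<And>n. x \<le> C * exp (- 1) ^ n"
  shows "x \<le> 0"
proof -
  have "(\<lambda>n. C * exp (- 1 :: real) ^ n) \<longlonglongrightarrow> C * 0"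
    by (intro tendsto_intros LIMSEQ_realpow_zero) auto
  then show ?thesis
    using assms LIMSEQ_le_const by fastforce
qed

text \<open>The coefficients of \<open>(H z - H z0) / (exp z - exp z0)\<close> form a geometric sequence on
  either side of 0; boundedness on vertical lines to the right and to the left of \<open>z0\<close>
  makes both vanish.\<close>

lemma fourier_coeff_zero_imp_zero:
  assumes hol: "H holomorphic_on UNIV"
    and per: "\<And>z. H (z + 2 * of_real pi * \<i>) = H z"
    and zero: "\<And>n. fourier_coeff H n = 0"
  shows "H z0 = 0"
proof -
  define w where "w = exp z0"
  \<comment> \<open>At the points over \<open>w\<close> the value is the limit of the quotient:
    there \<open>exp\<close> has derivative \<open>w\<close> and \<open>H\<close> takes the value
    \<open>H z0\<close> by periodicity.\<close>
  define Q where "Q = (\<lambda>z. if exp z = w then deriv H z / w else (H z - H z0) / (exp z - w))"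
  have w0: "w \<noteq> 0" by (simp add: w_def)
  have Hd: "(H has_field_derivative deriv H z) (at z)" for z
    using hol by (intro holomorphic_derivI) auto
  have HQ: "H z = H z0" if w: "exp z = w" for z
  proof -
    obtain n :: int where "z = z0 + of_int (2 * n) * of_real pi * \<i>"
      using w exp_eq[of z z0] w_def by auto
    then show ?thesis
      using periodic_int[where H = H, OF per, of z0 n] by simp
  qed
  have "continuous_on UNIV (exp :: complex \<Rightarrow> complex)" by (intro continuous_intros)
  then have opn: "open {z::complex. exp z \<noteq> w}"
    by (intro open_Collect_neq continuous_intros)
  have holQ: "Q holomorphic_on UNIV"
  proof -
    have h1: "Q holomorphic_on {z. exp z \<noteq> w}"
    proof -
      have "(\<lambda>z. (H z - H z0) / (exp z - w)) holomorphic_on {z. exp z \<noteq> w}"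
        by (intro holomorphic_intros holomorphic_on_subset[OF hol]) auto
      then show ?thesis
        by (rule holomorphic_transform) (auto simp: Q_def)
    qed
    \<comment> \<open>The solutions of \<open>exp z = w\<close> are at least \<open>2 pi\<close>
      apart, so a unit ball around one contains no other and the singularity is isolated and
      removable.\<close>
    have h2: "Q holomorphic_on ball z1 1" if z1: "exp z1 = w" for z1
    proof (rule no_isolated_singularity'[where K = "{z1}"])
      have ne: "exp z \<noteq> w" if "z \<in> ball z1 1 - {z1}" for z
      proof
        assume w: "exp z = w"
        then obtain n :: int where n: "z = z1 + of_int (2 * n) * of_real pi * \<i>"
          using exp_eq[of z z1] z1 w by auto
        have "norm (z1 - z) = 2 * \<bar>of_int n\<bar> * pi"
          by (simp add: n norm_mult)
        then have "2 * \<bar>of_int n\<bar> * pi < 1"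
          using that by (simp add: dist_norm)
        moreover have "2 * \<bar>of_int n :: real\<bar> * pi \<ge> 2 * \<bar>of_int n\<bar> * 1"
          using pi_gt3 by (intro mult_left_mono) auto
        ultimately have "\<bar>of_int n :: real\<bar> < 1" by linarith
        then have "n = 0" by linarith
        then show False using n that by simp
      qed
      show "Q holomorphic_on ball z1 1 - {z1}"
        by (rule holomorphic_on_subset[OF h1]) (use ne in blast)
      have lim: "((\<lambda>z. ((H z - H z1) / (z - z1)) / ((exp z - exp z1) / (z - z1))) \<longlongrightarrow> deriv H z1 / exp z1) (at z1)"
        using Hd[of z1] DERIV_exp[of z1]
        by (intro tendsto_divide) (auto simp: has_field_derivative_iff)
      have "eventually (\<lambda>z. z \<in> ball z1 1 - {z1}) (at z1)"
        by (rule eventually_at_in_open) auto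
      then have "eventually (\<lambda>z. ((H z - H z1) / (z - z1)) / ((exp z - exp z1) / (z - z1)) = Q z) (at z1)"
      proof eventually_elim
        case (elim z)
        then show ?case using ne[OF elim] HQ[OF z1] z1 by (auto simp: Q_def)
      qed
      from tendsto_cong[OF this] lim have "(Q \<longlongrightarrow> Q z1) (at z1)"
        by (simp add: Q_def z1)
      then show "(Q \<longlongrightarrow> Q z) (at z within ball z1 1)" if "z \<in> {z1}" for z
        using that by (auto intro: tendsto_within_subset)
    qed auto
    have "Q holomorphic_on {z. exp z \<noteq> w} \<union> (\<Union>z1\<in>{z. exp z = w}. ball z1 1)"
      using h1 h2 opn by (intro holomorphic_on_Un holomorphic_on_UN_open) auto
    moreover have "{z. exp z \<noteq> w} \<union> (\<Union>z1\<in>{z. exp z = w}. ball z1 1) = UNIV"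
      by (auto intro: centre_in_ball[THEN iffD2])
    ultimately show ?thesis by simp
  qed
  have derper: "deriv H (z + 2 * of_real pi * \<i>) = deriv H z" for z
  proof -
    have "(H has_field_derivative deriv H (z + 2 * of_real pi * \<i>)) (at z)"
      using Hd[of "z + 2 * of_real pi * \<i>"] by (simp add: DERIV_shift per)
    then show ?thesis using DERIV_unique Hd by blast
  qed
  have perQ: "Q (z + 2 * of_real pi * \<i>) = Q z" for z
    by (simp only: Q_def per derper exp_period)
  define b where "b = fourier_coeff Q"
  \<comment> \<open>Compare coefficients in \<open>exp z * Q z - w * Q z = H z - H z0\<close>. All
    coefficients of \<open>H\<close> vanish, so the constant \<open>H z0\<close> contributes at
    index 0 only; it is zero once \<open>b 0\<close> and \<open>b (- 1)\<close> are.\<close>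
  have rel: "b (n - 1) - w * b n = - H z0 * (if n = 0 then 2 * of_real pi * \<i> else 0)" for n
  proof -
    define S where "S = (\<lambda>z. exp (of_int 1 * z) * Q (z + 0))"
    have "(\<lambda>z. 1 * S z + (- w) * Q z) = (\<lambda>z. 1 * H z + (- H z0) * 1)"
      by (rule ext) (use w0 HQ in \<open>auto simp: Q_def S_def field_simps\<close>)
    moreover have "fourier_coeff (\<lambda>z. 1 * H z + (- H z0) * 1) n
        = 1 * fourier_coeff H n + (- H z0) * fourier_coeff (\<lambda>_. 1) n"
      by (rule fourier_coeff_linear[where H = H and K = "\<lambda>_. 1", OF hol _ per]) auto
    moreover have "fourier_coeff (\<lambda>z. 1 * S z + (- w) * Q z) n
        = 1 * fourier_coeff S n + (- w) * fourier_coeff Q n"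
    proof (rule fourier_coeff_linear[where H = S and K = Q, OF _ holQ _ perQ])
      show "S (z + 2 * of_real pi * \<i>) = S z" for z
        unfolding S_def exp_int_period add_0_right perQ ..
    qed (use holQ in \<open>auto simp: S_def intro!: holomorphic_intros\<close>)
    moreover have "fourier_coeff S n = exp (of_int (n - 1) * 0) * fourier_coeff Q (n - 1)"
      unfolding S_def by (rule fourier_coeff_shift[where H = Q, OF holQ perQ])
    ultimately show ?thesis
      using zero fourier_coeff_const[of 1 n] by (cases "n = 0") (simp_all add: b_def)
  qed
  have normw: "norm w = exp (Re z0)" by (simp add: w_def)
  have pos: "b 0 = w ^ n * b (int n)" for n
  proof (induction n)
    case (Suc n)
    have "b (int n) = w * b (int (Suc n))"
      using rel[of "int (Suc n)"] by simp
    with Suc show ?case by simp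
  qed simp
  have neg: "b (- 1 - int n) = w ^ n * b (- 1)" for n
  proof (induction n)
    case (Suc n)
    have "b (- 1 - int (Suc n)) = w * b (- 1 - int n)"
      using rel[of "- 1 - int n"] by (simp add: algebra_simps)
    with Suc show ?case by simp
  qed simp
  have "b 0 = 0"
  proof -
    obtain M where M: "\<And>n. norm (b n) \<le> M * exp (- of_int n * (Re z0 + 1))"
      using fourier_coeff_bound[where H = Q, OF holQ perQ] unfolding b_def by blast
    have "norm (b 0) \<le> M * exp (- 1) ^ n" for n
    proof -
      have "norm (b 0) = exp (Re z0) ^ n * norm (b (int n))"
        by (subst pos[of n]) (simp add: norm_mult norm_power normw)
      also have "\<dots> \<le> exp (Re z0) ^ n * (M * exp (- of_int (int n) * (Re z0 + 1)))"
        by (intro mult_left_mono M) auto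
      also have "\<dots> = M * exp (- 1) ^ n"
        by (simp add: exp_of_nat_mult[symmetric] mult_exp_exp algebra_simps)
      finally show ?thesis .
    qed
    from geometric_bound_nonpos[OF this] show ?thesis by simp
  qed
  moreover have "b (- 1) = 0"
  proof -
    obtain M where M: "\<And>n. norm (b n) \<le> M * exp (- of_int n * (Re z0 - 1))"
      using fourier_coeff_bound[where H = Q, OF holQ perQ] unfolding b_def by blast
    have "norm (b (- 1)) \<le> (M * exp (Re z0 - 1)) * exp (- 1) ^ n" for n
    proof -
      have "exp (Re z0) ^ n * norm (b (- 1)) = norm (b (- 1 - int n))"
        by (simp add: neg norm_mult norm_power normw)
      also have "\<dots> \<le> M * exp (- of_int (- 1 - int n) * (Re z0 - 1))"
        by (rule M)
      also have "\<dots> = exp (Re z0) ^ n * (M * exp (Re z0 - 1) * exp (- 1) ^ n)"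
        by (simp add: exp_of_nat_mult[symmetric] mult_exp_exp algebra_simps)
      finally show ?thesis by simp
    qed
    from geometric_bound_nonpos[OF this] show ?thesis by simp
  qed
  ultimately show ?thesis using rel[of 0] by simp
qed

section \<open>Uniqueness for the difference equation, in the variable \<open>z\<close> with
  \<open>X = exp z\<close> and \<open>P\<close> in the role of a logarithm of
  \<open>q^2\<close>\<close>

locale theta_equation =
  fixes q P l :: complex and H :: "complex \<Rightarrow> complex"
  assumes q0: "q \<noteq> 0"
    and hol: "H holomorphic_on UNIV"
    and per: "\<And>z. H (z + 2 * of_real pi * \<i>) = H z"
    and even: "\<And>z. H (- z) = H z"
    and eqn: "\<And>z. q * (exp z * H (z + P)) + q * (exp (- z) * H (z - P)) = l * H z"
begin

lemma coeff_recurrence: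
  "q * (exp (of_int (n - 1) * P) * fourier_coeff H (n - 1))
    + q * (exp (- of_int (n + 1) * P) * fourier_coeff H (n + 1)) = l * fourier_coeff H n"
proof -
  define S where "S = (\<lambda>k c z. exp (of_int k * z) * H (z + c))"
  have "H (z + 2 * of_real pi * \<i> + c) = H (z + c)" for z c
    using per[of "z + c"] by (simp add: add_ac)
  then have perS: "S k c (z + 2 * of_real pi * \<i>) = S k c z" for z c k
    unfolding S_def exp_int_period by simp
  have "(H \<circ> (\<lambda>z. z + c)) holomorphic_on UNIV" for c
    by (rule holomorphic_on_compose_gen[OF _ hol]) (auto intro!: holomorphic_intros)
  then have "(\<lambda>z. H (z + c)) holomorphic_on UNIV" for c
    by (simp add: o_def)
  then have holS: "S k c holomorphic_on UNIV" for k c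
    unfolding S_def by (intro holomorphic_intros)
  have shift: "fourier_coeff (S k c) n = exp (of_int (n - k) * c) * fourier_coeff H (n - k)" for k c
    unfolding S_def by (rule fourier_coeff_shift[where H = H, OF hol per])
  have "(\<lambda>z. q * S 1 P z + q * S (- 1) (- P) z) = (\<lambda>z. l * H z + 0 * H z)"
    by (rule ext) (use eqn in \<open>simp add: S_def\<close>)
  moreover have "fourier_coeff (\<lambda>z. q * S 1 P z + q * S (- 1) (- P) z) n
      = q * fourier_coeff (S 1 P) n + q * fourier_coeff (S (- 1) (- P)) n"
    by (rule fourier_coeff_linear[where H = "S 1 P" and K = "S (- 1) (- P)", OF holS holS perS perS])
  moreover have "fourier_coeff (\<lambda>z. l * H z + 0 * H z) n = l * fourier_coeff H n + 0 * fourier_coeff H n"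
    by (rule fourier_coeff_linear[where H = H and K = H, OF hol hol per per])
  ultimately have "q * fourier_coeff (S 1 P) n + q * fourier_coeff (S (- 1) (- P)) n = l * fourier_coeff H n"
    by simp
  then show ?thesis
    unfolding shift by (simp add: algebra_simps)
qed

lemma coeff_even: "fourier_coeff H (- n) = fourier_coeff H n"
  using fourier_coeff_reflect[where H = H, OF hol per, of n] even by simp

text \<open>At index 0 the two outer coefficients agree by evenness and carry the same factor, so
  the recurrence determines the coefficient at 1 from the one at 0. From there it is solved upwards,
  since \<open>q\<close> and the exponentials are nonzero; evenness covers the negative
  indices.\<close>

lemma zero_if_coeff_zero:
  assumes "fourier_coeff H 0 = 0"
  shows "H z = 0"
proof (rule fourier_coeff_zero_imp_zero[where H = H, OF hol per])
  have "fourier_coeff H 1 = 0"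
    using coeff_recurrence[of 0] coeff_even[of 1] assms q0 by simp
  have nat: "fourier_coeff H (int n) = 0 \<and> fourier_coeff H (int (Suc n)) = 0" for n
  proof (induction n)
    case 0
    then show ?case using assms \<open>fourier_coeff H 1 = 0\<close> by simp
  next
    case (Suc n)
    have i: "int (Suc n) - 1 = int n" "int (Suc n) + 1 = int (Suc (Suc n))"
      by auto
    from Suc coeff_recurrence[of "int (Suc n)"] q0 show ?case
      unfolding i by (simp del: of_nat_Suc)
  qed
  show "fourier_coeff H n = 0" for n
    by (cases n rule: int_cases2) (simp_all add: coeff_even nat)
qed

end

text \<open>The combination \<open>?L\<close> is chosen so that its coefficient at 0 cancels, hence
  it vanishes. The cross-multiplied form states proportionality without a division, so it also holds
  where a solution is zero.\<close>

theorem theta_equation_unique: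
  assumes "theta_equation q P l H" "theta_equation q P l K"
  shows "H z * K w = H w * K z"
proof -
  interpret H: theta_equation q P l H by fact
  interpret K: theta_equation q P l K by fact
  let ?L = "\<lambda>z. fourier_coeff K 0 * H z + (- fourier_coeff H 0) * K z"
  interpret L: theta_equation q P l ?L
  proof
    show "?L holomorphic_on UNIV"
      using H.hol K.hol by (intro holomorphic_intros)
    show "q * (exp z * ?L (z + P)) + q * (exp (- z) * ?L (z - P)) = l * ?L z" for z
    proof -
      have "q * (exp z * ?L (z + P)) + q * (exp (- z) * ?L (z - P))
        = fourier_coeff K 0 * (q * (exp z * H (z + P)) + q * (exp (- z) * H (z - P)))
          + (- fourier_coeff H 0) * (q * (exp z * K (z + P)) + q * (exp (- z) * K (z - P)))"
        by (simp only: ring_distribs mult_ac add_ac)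
      also have "\<dots> = l * ?L z"
        unfolding H.eqn K.eqn by (simp only: ring_distribs mult_ac)
      finally show ?thesis .
    qed
    show "?L (z + 2 * of_real pi * \<i>) = ?L z" for z
      by (simp only: H.per K.per)
    show "?L (- z) = ?L z" for z
      by (simp only: H.even K.even)
  qed (rule H.q0)
  have "fourier_coeff ?L 0 = 0"
    unfolding fourier_coeff_linear[where H = H and K = K, OF H.hol K.hol H.per K.per,
        where a = "fourier_coeff K 0" and b = "- fourier_coeff H 0" and n = 0]
    by simp
  then have L: "fourier_coeff K 0 * H z = fourier_coeff H 0 * K z" for z
    using L.zero_if_coeff_zero[of z] by simp
  show ?thesis
  proof (cases "fourier_coeff K 0 = 0")
    case True
    then show ?thesis using K.zero_if_coeff_zero by simp
  next
    case False
    have "fourier_coeff K 0 * (H z * K w) = fourier_coeff K 0 * (H w * K z)"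
      using L[of z] L[of w] by algebra
    with False show ?thesis by simp
  qed
qed

section \<open>Infinite products and theta functions\<close>

definition qprod :: "complex \<Rightarrow> complex \<Rightarrow> nat \<Rightarrow> complex"
  where "qprod b p n = (\<Prod>j<n. 1 - b * p ^ j)"

definition qprod_inf :: "complex \<Rightarrow> complex \<Rightarrow> complex"
  where "qprod_inf b p = (\<Prod>j. 1 - b * p ^ j)"

lemma qprod_0 [simp]: "qprod b p 0 = 1"
  by (simp add: qprod_def)

lemma qprod_Suc: "qprod b p (Suc n) = qprod b p n * (1 - b * p ^ n)"
  by (simp add: qprod_def)

lemma qprod_Suc': "qprod b p (Suc n) = (1 - b) * qprod (b * p) p n"
  unfolding qprod_def by (subst prod.lessThan_Suc_shift) (simp add: mult.assoc)

lemma qprod_shift: "(1 - b) * qprod (b * p) p n = qprod b p n * (1 - b * p ^ n)"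
  by (metis qprod_Suc qprod_Suc')

lemma qprod_eq_0_iff: "qprod b p n = 0 \<longleftrightarrow> (\<exists>j<n. b * p ^ j = 1)"
  by (auto simp: qprod_def)

context
  fixes p :: complex
  assumes p: "norm p < 1"
begin

lemma convergent_prod_qprod: "convergent_prod (\<lambda>j. 1 - b * p ^ j)"
proof -
  have "summable (\<lambda>j. norm ((1 - b * p ^ j) - 1))"
    using p by (simp add: norm_mult norm_power summable_mult summable_geometric)
  then show ?thesis
    using abs_convergent_prod_conv_summable abs_convergent_prod_imp_convergent_prod by blast
qed

lemma qprod_inf_split: "qprod_inf b p = qprod b p n * qprod_inf (b * p ^ n) p"
  using has_prod_unique[OF has_prod_ignore_initial_segment'[OF convergent_prod_qprod[of b], of n]]
  by (simp add: qprod_inf_def qprod_def power_add mult_ac)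

lemma qprod_inf_Suc: "qprod_inf b p = (1 - b) * qprod_inf (b * p) p"
  using qprod_inf_split[of b 1] by (simp add: qprod_Suc)

lemma qprod_inf_eq_0_iff: "qprod_inf b p = 0 \<longleftrightarrow> (\<exists>j. b * p ^ j = 1)"
proof -
  have "(\<lambda>j. 1 - b * p ^ j) has_prod qprod_inf b p"
    using convergent_prod_qprod by (simp add: convergent_prod_has_prod qprod_inf_def)
  from has_prod_eq_0_iff[OF this] show ?thesis by auto
qed

lemma qprod_inf_nonzero: "norm b < 1 \<Longrightarrow> qprod_inf b p \<noteq> 0"
proof
  assume b: "norm b < 1" and "qprod_inf b p = 0"
  then obtain j where "b * p ^ j = 1"
    by (auto simp: qprod_inf_eq_0_iff)
  then have "norm b * norm p ^ j = 1"
    by (metis norm_mult norm_one norm_power)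
  moreover have "norm b * norm p ^ j \<le> norm b * 1"
    using p by (intro mult_left_mono power_le_one) auto
  ultimately show False using b by simp
qed

lemma qprod_tendsto: "qprod b p \<longlonglongrightarrow> qprod_inf b p"
proof -
  have "(\<lambda>j. 1 - b * p ^ j) has_prod qprod_inf b p"
    using convergent_prod_qprod by (simp add: convergent_prod_has_prod qprod_inf_def)
  from has_prod_imp_tendsto'[OF this] show ?thesis
    by (simp add: qprod_def[abs_def])
qed

text \<open>The estimate \<open>1 + t \<le> exp t\<close> for each factor puts a geometric sum into
  the exponent. The bound is independent of \<open>n\<close>, as the Weierstrass test for the series
  requires.\<close>

lemma norm_qprod_le: "norm (qprod b p n) \<le> exp (norm b / (1 - norm p))"
proof -
  have "norm (qprod b p n) \<le> (\<Prod>j<n. exp (norm b * norm p ^ j))"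
    unfolding qprod_def prod_norm[symmetric]
  proof (rule prod_mono, safe)
    fix j
    have "norm (1 - b * p ^ j) \<le> 1 + norm b * norm p ^ j"
      using norm_triangle_ineq4[of 1 "b * p ^ j"] by (simp add: norm_mult norm_power)
    also have "\<dots> \<le> exp (norm b * norm p ^ j)"
      by (rule exp_ge_add_one_self)
    finally show "norm (1 - b * p ^ j) \<le> exp (norm b * norm p ^ j)" .
  qed simp
  also have "\<dots> = exp (norm b * (\<Sum>j<n. norm p ^ j))"
    by (simp add: exp_sum sum_distrib_left)
  also have "\<dots> \<le> exp (norm b * (1 / (1 - norm p)))"
  proof -
    have "(\<Sum>j<n. norm p ^ j) \<le> (\<Sum>j. norm p ^ j)"
      using p by (intro sum_le_suminf summable_geometric) auto
    then show ?thesis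
      using p by (subst exp_le_cancel_iff, intro mult_left_mono) (simp_all add: suminf_geometric)
  qed
  finally show ?thesis by simp
qed

lemma norm_qprod_inf_le: "norm (qprod_inf b p) \<le> exp (norm b / (1 - norm p))"
  by (rule Lim_bounded[OF tendsto_norm[OF qprod_tendsto]]) (use norm_qprod_le in blast)

lemma holomorphic_qprod_inf: "(\<lambda>b. qprod_inf b p) holomorphic_on UNIV"
proof (rule holomorphic_uniform_sequence[where f = "\<lambda>n b. qprod b p n"])
  show "(\<lambda>b. qprod b p n) holomorphic_on UNIV" for n
    unfolding qprod_def by (intro holomorphic_intros)
  fix x :: complex
  have "uniformly_convergent_on (cball x 1) (\<lambda>n b. \<Prod>j<n. 1 + (- b * p ^ j))"
  proof (rule uniformly_convergent_on_prod)
    show "uniformly_convergent_on (cball x 1) (\<lambda>N b. \<Sum>j<N. norm (- b * p ^ j))"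
    proof (rule Weierstrass_m_test'[where M = "\<lambda>j. (norm x + 1) * norm p ^ j"])
      show "norm (norm (- b * p ^ j)) \<le> (norm x + 1) * norm p ^ j" if "b \<in> cball x 1" for j b
      proof -
        have "norm b \<le> norm x + 1"
          using that norm_triangle_ineq2[of b x] by (simp add: dist_norm norm_minus_commute)
        then show ?thesis
          by (simp add: norm_mult norm_power mult_right_mono)
      qed
      show "summable (\<lambda>j. (norm x + 1) * norm p ^ j)"
        using p by (intro summable_mult summable_geometric) auto
    qed
  qed (auto intro!: continuous_intros)
  then have "uniformly_convergent_on (cball x 1) (\<lambda>n b. qprod b p n)"
    by (simp add: qprod_def)
  then obtain g where g: "uniform_limit (cball x 1) (\<lambda>n b. qprod b p n) g sequentially"
    unfolding uniformly_convergent_on_def by blast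
  have "g b = qprod_inf b p" if "b \<in> cball x 1" for b
    using tendsto_uniform_limitI[OF g that] qprod_tendsto[of b] LIMSEQ_unique by blast
  then have "uniform_limit (cball x 1) (\<lambda>n b. qprod b p n) (\<lambda>b. qprod_inf b p) sequentially"
    using g by (subst uniform_limit_cong'[where g = "\<lambda>n b. qprod b p n" and i = g]) auto
  then show "\<exists>d>0. cball x d \<subseteq> UNIV \<and> uniform_limit (cball x d) (\<lambda>n b. qprod b p n) (\<lambda>b. qprod_inf b p) sequentially"
    by (intro exI[of _ 1]) auto
qed auto

lemma holomorphic_on_qprod_inf [holomorphic_intros]:
  assumes "f holomorphic_on A"
  shows "(\<lambda>z. qprod_inf (f z) p) holomorphic_on A"
  using holomorphic_on_compose_gen[OF assms holomorphic_qprod_inf] by (simp add: o_def)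

end

lemma qprod_nonzero:
  assumes "norm p < 1" "norm b < 1"
  shows "qprod b p k \<noteq> 0"
  using qprod_inf_split[OF assms(1), of b k] qprod_inf_nonzero[OF assms] by auto

lemma qpoch_eq: "qpoch bs p k = (\<Prod>b\<leftarrow>bs. qprod b p k)"
  by (simp add: qpoch_def qprod_def)

lemma qpoch_inf_Nil: "qpoch_inf [] p = 1"
  and qpoch_inf_Cons: "qpoch_inf (b # bs) p = qprod_inf b p * qpoch_inf bs p"
  by (simp_all add: qpoch_inf_def qprod_inf_def)

lemmas qpoch_inf_simps = qpoch_inf_Nil qpoch_inf_Cons mult_1_right

text \<open>This is \<open>vtheta\<close> in the multiplicative variable \<open>q^x\<close>. By
  Jacobi's triple product it is, up to a constant factor, the sum of \<open>q^(n^2) x^n\<close> over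
  all integers \<open>n\<close>.\<close>

definition theta_mult :: "complex \<Rightarrow> complex \<Rightarrow> complex"
  where "theta_mult q x = qprod_inf (- q * x) (q\<^sup>2) * qprod_inf (- q / x) (q\<^sup>2)"

lemma norm_power2_less_1: "norm (q::complex) < 1 \<Longrightarrow> norm (q\<^sup>2) < 1"
  by (simp add: norm_power power_less_one_iff)

text \<open>The shift removes the factor \<open>1 + q x\<close> from one product and adds
  \<open>1 + 1 / (q x)\<close> to the other; the quotient of the two is \<open>q x\<close>.\<close>

lemma theta_mult_shift:
  assumes "norm q < 1" "q \<noteq> 0" "x \<noteq> 0"
  shows "q * x * theta_mult q (q\<^sup>2 * x) = theta_mult q x"
proof -
  note p = norm_power2_less_1[OF assms(1)]
  have a: "qprod_inf (- q * x) (q\<^sup>2) = (1 + q * x) * qprod_inf (- q * (q\<^sup>2 * x)) (q\<^sup>2)"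
    using qprod_inf_Suc[OF p, of "- q * x"] by (simp add: mult_ac)
  have b: "qprod_inf (- q / (q\<^sup>2 * x)) (q\<^sup>2) = (1 + 1 / (q * x)) * qprod_inf (- q / x) (q\<^sup>2)"
    using qprod_inf_Suc[OF p, of "- q / (q\<^sup>2 * x)"] assms by (simp add: power2_eq_square)
  have "1 + q * x = q * x * (1 + 1 / (q * x))"
    using assms by (simp add: field_simps)
  then show ?thesis
    unfolding theta_mult_def a b by (simp only: mult_ac)
qed

lemma holomorphic_on_theta_mult [holomorphic_intros]:
  assumes "norm q < 1" "f holomorphic_on A" "\<And>z. z \<in> A \<Longrightarrow> f z \<noteq> 0"
  shows "(\<lambda>z. theta_mult q (f z)) holomorphic_on A"
  unfolding theta_mult_def
  by (intro holomorphic_intros norm_power2_less_1 assms)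

text \<open>Each summand solves the equation on its own: for \<open>theta_mult q (m X)\<close> the
  upward shift contributes \<open>1 / m\<close> and the downward shift \<open>m\<close>, and for the
  other summand the roles are exchanged. The sum is needed for evenness.\<close>

lemma theta_equation_theta:
  assumes "norm q < 1" "q \<noteq> 0" "m \<noteq> 0" and P: "exp P = q\<^sup>2"
  shows "theta_equation q P (m + 1 / m) (\<lambda>z. theta_mult q (m * exp z) + theta_mult q (m * exp (- z)))"
proof
  show "q \<noteq> 0" by fact
  show "(\<lambda>z. theta_mult q (m * exp z) + theta_mult q (m * exp (- z))) holomorphic_on UNIV"
    using assms by (intro holomorphic_intros) auto
  fix z
  have "exp (- (z + 2 * of_real pi * \<i>)) = exp (- z)"
    using exp_period[of "- z - 2 * of_real pi * \<i>"] by simp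
  then show "theta_mult q (m * exp (z + 2 * of_real pi * \<i>)) + theta_mult q (m * exp (- (z + 2 * of_real pi * \<i>)))
      = theta_mult q (m * exp z) + theta_mult q (m * exp (- z))"
    by (simp only: exp_period)
  show "theta_mult q (m * exp (- z)) + theta_mult q (m * exp (- (- z)))
      = theta_mult q (m * exp z) + theta_mult q (m * exp (- z))"
    by simp
  define X where "X = exp z"
  define a where "a = theta_mult q (m * X)"
  define b where "b = theta_mult q (m / X)"
  have X: "X \<noteq> 0" by (simp add: X_def)
  have e: "exp (- z) = 1 / X" "exp (z + P) = q\<^sup>2 * X" "exp (- (z + P)) = 1 / (q\<^sup>2 * X)"
    "exp (z - P) = X / q\<^sup>2" "exp (- (z - P)) = q\<^sup>2 / X"
    by (simp_all add: X_def exp_add exp_diff exp_minus P field_simps)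
  note sh = theta_mult_shift[OF assms(1,2)]
  have s1: "theta_mult q (m * (q\<^sup>2 * X)) = a / (q * m * X)"
    using sh[of "m * X"] assms X by (simp add: a_def field_simps)
  have s2: "theta_mult q (m * (q\<^sup>2 / X)) = b * X / (q * m)"
    using sh[of "m / X"] assms X by (simp add: b_def field_simps)
  have "q * (m * (X / q\<^sup>2)) * theta_mult q (q\<^sup>2 * (m * (X / q\<^sup>2))) = theta_mult q (m * (X / q\<^sup>2))"
    using assms X by (intro sh) auto
  then have s3: "theta_mult q (m * (X / q\<^sup>2)) = a * (m * X) / q"
    using assms X by (simp add: a_def field_simps power2_eq_square)
  have "q * (m * (1 / (q\<^sup>2 * X))) * theta_mult q (q\<^sup>2 * (m * (1 / (q\<^sup>2 * X)))) = theta_mult q (m * (1 / (q\<^sup>2 * X)))"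
    using assms X by (intro sh) auto
  then have s4: "theta_mult q (m * (1 / (q\<^sup>2 * X))) = b * m / (q * X)"
    using assms X by (simp add: b_def field_simps power2_eq_square)
  show "q * (exp z * (theta_mult q (m * exp (z + P)) + theta_mult q (m * exp (- (z + P)))))
      + q * (exp (- z) * (theta_mult q (m * exp (z - P)) + theta_mult q (m * exp (- (z - P)))))
      = (m + 1 / m) * (theta_mult q (m * exp z) + theta_mult q (m * exp (- z)))"
  proof -
    have f: "theta_mult q (m * X) = a" "theta_mult q (m * (1 / X)) = b"
      by (simp_all add: a_def b_def)
    show ?thesis
      unfolding e X_def[symmetric] s1 s2 s3 s4 f using assms X by (simp add: field_simps)
  qed
qed

section \<open>The very-well-poised series\<close>

text \<open>The start of the telescoping sum: both sides are to be multiplied by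
  \<open>1 + m / q\<close> and by the infinite products common to \<open>basis 0\<close> at
  \<open>q^2 X\<close>, \<open>X / q^2\<close> and \<open>X\<close>.\<close>

lemma difference_identity_0:
  fixes q m X :: complex
  assumes "q \<noteq> 0" "m \<noteq> 0" "X \<noteq> 0"
  shows "q * X * ((1 + m / (q * X)) * (1 + q * m / X)) + q / X * ((1 + m / q * X) * (1 + q * m * X))
      - (m + 1 / m) * ((1 + q * m * X) * (1 + q * m / X)) = - ((1 + q * m) / m) * ((1 - m\<^sup>2) * (1 - q * m))"
proof -
  \<comment> \<open>With the inverses as variables of their own the claim is a polynomial identity
    modulo the relations \<open>rel\<close>, which \<open>algebra\<close> can decide.\<close>
  define v where "v = 1 / X"
  define r where "r = 1 / q"
  define n where "n = 1 / m"
  have rel: "X * v = 1" "q * r = 1" "m * n = 1"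
    using assms by (simp_all add: v_def r_def n_def)
  have "q * X * ((1 + m * (r * v)) * (1 + q * m * v)) + q * v * ((1 + m * r * X) * (1 + q * m * X))
      - (m + n) * ((1 + q * m * X) * (1 + q * m * v)) = - ((1 + q * m) * n) * ((1 - m\<^sup>2) * (1 - q * m))"
    using rel by algebra
  then show ?thesis by (simp add: v_def r_def n_def)
qed

text \<open>The induction step of the telescoping sum, with \<open>w = p^n\<close> and
  \<open>y = p^(n+1)\<close> for \<open>p = q^2\<close>. After division by a common factor the left
  side is the operator applied to the summand of index \<open>n + 1\<close>; the two terms on the
  right are the remainder of index \<open>n + 1\<close> and minus the remainder of index
  \<open>n\<close>.\<close>

lemma difference_identity_Suc:
  fixes q m X w y :: complex
  assumes "q \<noteq> 0" "m \<noteq> 0" "X \<noteq> 0" "X \<noteq> 1" and y: "y = q\<^sup>2 * w"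
  shows "(1 + m * y\<^sup>2 / q) *
    (q * X * ((1 - X * w) * (1 - X * y) / (1 - X) * (1 - 1 / (q\<^sup>2 * X)) * ((1 + q * m * w / X) * (1 + q * m * y / X)))
     + q / X * ((1 - w / X) * (1 - y / X) / (1 - 1 / X) * (1 - X / q\<^sup>2) * ((1 + q * m * w * X) * (1 + q * m * y * X)))
     - (m + 1 / m) * ((1 - X * w) * (1 - w / X) * ((1 + q * m * y * X) * (1 + q * m * y / X))))
   = - ((1 + q * m) / m) * ((1 + m * y / q) * (1 - m\<^sup>2 * y\<^sup>2) * (1 - q * m * y)) * ((1 - X * w) * (1 - w / X))
     - (1 + q * m) / q * ((1 - y) * (1 - q\<^sup>2 * w\<^sup>2) * (1 + w)) * ((1 + q * m * y * X) * (1 + q * m * y / X))"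
proof -
  define v where "v = 1 / X"
  define d where "d = 1 - X"
  define r where "r = 1 / q"
  define n where "n = 1 / m"
  have rel: "X * v = 1" "q * r = 1" "m * n = 1"
    using assms by (simp_all add: v_def r_def n_def)
  \<comment> \<open>The denominators \<open>1 - X\<close> and \<open>1 - 1 / X\<close> differ by the
    unit \<open>- v\<close>, so a single division by \<open>d\<close> remains, and it is removed
    before the polynomial identity is proved.\<close>
  have d: "d \<noteq> 0" "1 - X = d" "1 - 1 / X = - (v * d)"
    using assms by (simp_all add: d_def v_def field_simps)
  have "v \<noteq> 0" using rel by auto
  then have P: "q * X * (a / d * b * c) + q * v * (e / (- (v * d)) * f * g) = (q * X * (a * b * c) - q * (e * f * g)) / d"
    for a b c e f g
    using d(1) by (simp add: field_simps)
  have "(1 + m * y\<^sup>2 * r) *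
    ((q * X * ((1 - X * w) * (1 - X * y) * (1 - r\<^sup>2 * v) * ((1 + q * m * w * v) * (1 + q * m * y * v)))
     - q * ((1 - w * v) * (1 - y * v) * (1 - X * r\<^sup>2) * ((1 + q * m * w * X) * (1 + q * m * y * X))))
     - d * (m + n) * ((1 - X * w) * (1 - w * v) * ((1 + q * m * y * X) * (1 + q * m * y * v))))
   = d * (- ((1 + q * m) * n) * ((1 + m * y * r) * (1 - m\<^sup>2 * y\<^sup>2) * (1 - q * m * y)) * ((1 - X * w) * (1 - w * v))
     - (1 + q * m) * r * ((1 - y) * (1 - q\<^sup>2 * w\<^sup>2) * (1 + w)) * ((1 + q * m * y * X) * (1 + q * m * y * v)))"
    using rel y d_def by algebra
  moreover have "a * (b / d - c) = e" if "a * (b - d * c) = d * e" for a b c e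
    using that d(1) by (simp add: field_simps)
  ultimately have *: "(1 + m * y\<^sup>2 * r) *
    ((q * X * ((1 - X * w) * (1 - X * y) * (1 - r\<^sup>2 * v) * ((1 + q * m * w * v) * (1 + q * m * y * v)))
     - q * ((1 - w * v) * (1 - y * v) * (1 - X * r\<^sup>2) * ((1 + q * m * w * X) * (1 + q * m * y * X)))) / d
     - (m + n) * ((1 - X * w) * (1 - w * v) * ((1 + q * m * y * X) * (1 + q * m * y * v))))
   = (- ((1 + q * m) * n) * ((1 + m * y * r) * (1 - m\<^sup>2 * y\<^sup>2) * (1 - q * m * y)) * ((1 - X * w) * (1 - w * v))
     - (1 + q * m) * r * ((1 - y) * (1 - q\<^sup>2 * w\<^sup>2) * (1 + w)) * ((1 + q * m * y * X) * (1 + q * m * y * v)))"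
    by (simp only: mult.assoc)
  have inv: "a / X = a * v" "a / q = a * r" "a / m = a * n" "a / q\<^sup>2 = a * r\<^sup>2" "1 / (q\<^sup>2 * X) = r\<^sup>2 * v" for a
    by (simp_all add: v_def r_def n_def power_divide)
  show ?thesis
    unfolding d(2,3) using *[folded P] by (simp only: inv mult_1)
qed

text \<open>The assumption \<open>qm\<close> says that the argument \<open>- q / m\<close> of the
  series has modulus below 1.\<close>

locale special_W87 =
  fixes q m :: complex
  assumes q0: "q \<noteq> 0" and q1: "norm q < 1" and qm: "norm q < norm m"
begin

abbreviation p :: complex where "p \<equiv> q\<^sup>2"

text \<open>
  The terms of the series times \<open>(1 + m / q) (-q m X, -q m / X; p)\<^sub>\<infinity>\<close>; this clears all
  denominators that depend on \<open>X\<close>.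
\<close>

definition num :: "nat \<Rightarrow> complex"
  where "num k = qprod (- m / q) p k * qprod m p k * qprod (- m) p k * qprod (q * m) p k"

definition den :: "nat \<Rightarrow> complex"
  where "den k = qprod p p k * qprod (- q) p k * qprod q p k * qprod (- 1) p k"

definition coeff :: "nat \<Rightarrow> complex"
  where "coeff k = num k / den k * (- q / m) ^ k"

definition basis :: "nat \<Rightarrow> complex \<Rightarrow> complex"
  where "basis k X = qprod X p k * qprod (1 / X) p k *
    qprod_inf (- q * m * X * p ^ k) p * qprod_inf (- q * m / X * p ^ k) p"

definition summand :: "nat \<Rightarrow> complex \<Rightarrow> complex"
  where "summand k X = (1 + m * (p ^ k)\<^sup>2 / q) * coeff k * basis k X"

definition total :: "complex \<Rightarrow> complex"
  where "total X = (\<Sum>k. summand k X)"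

lemma p1: "norm p < 1"
  using q1 by (rule norm_power2_less_1)

lemma m0: "m \<noteq> 0"
  using qm by auto

lemma den_nonzero: "den k \<noteq> 0"
proof -
  \<comment> \<open>The parameter \<open>- 1\<close> lies on the unit circle: its first factor is 2,
    and the others form a product with parameter \<open>- p\<close> inside the disc.\<close>
  have "qprod (- 1) p k \<noteq> 0"
  proof (cases k)
    case (Suc i)
    then show ?thesis
      using qprod_nonzero[OF p1, of "- p" i] p1 by (simp add: qprod_Suc')
  qed simp
  then show ?thesis
    using p1 q1 by (simp add: den_def qprod_nonzero)
qed

lemma num_Suc: "num (Suc k) = num k * ((1 + m * p ^ k / q) * (1 - m\<^sup>2 * (p ^ k)\<^sup>2) * (1 - q * m * p ^ k))"
proof -
  have eq: "(1 + m * w / q) * (1 - m\<^sup>2 * w\<^sup>2) * (1 - q * m * w)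
    = (1 - - m / q * w) * ((1 - m * w) * (1 - - m * w)) * (1 - q * m * w)" for w
    by (simp add: power2_eq_square algebra_simps)
  show ?thesis
    unfolding eq num_def qprod_Suc by (simp only: mult_ac)
qed

lemma den_Suc: "den (Suc k) = den k * ((1 - p ^ Suc k) * (1 - q\<^sup>2 * (p ^ k)\<^sup>2) * (1 + p ^ k))"
proof -
  have eq: "(1 - p ^ Suc k) * (1 - q\<^sup>2 * w\<^sup>2) * (1 + w)
    = (1 - p * p ^ k) * ((1 - - q * w) * (1 - q * w)) * (1 - - 1 * w)" for w
    by (simp add: power2_eq_square algebra_simps)
  show ?thesis
    unfolding eq den_def qprod_Suc by (simp only: mult_ac)
qed

text \<open>
  The operator \<open>T f X = q X f(p X) + (q / X) f(X / p)\<close> maps \<open>basis k\<close> to a combination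
  \<open>A\<^sub>k basis (k - 1) + B\<^sub>k basis k + C\<^sub>k basis (k + 1)\<close>. The coefficients \<open>c\<^sub>k\<close> of \<open>basis k\<close> in the
  series satisfy \<open>c\<^sub>k\<^sub>+\<^sub>1 A\<^sub>k\<^sub>+\<^sub>1 = - c\<^sub>k C\<^sub>k / (q m)\<close>, so the partial sums of
  \<open>(T - (m + 1/m)) summand\<close> collapse to \<open>c\<^sub>n C\<^sub>n (basis (n + 1) + basis n / (q m))\<close>,
  which factors as follows.
\<close>

definition remainder :: "nat \<Rightarrow> complex \<Rightarrow> complex"
  where "remainder n X = - ((1 + q * m) / m) * (num (Suc n) / den n * (- q / m) ^ n) *
    (qprod X p n * qprod (1 / X) p n *
      (qprod_inf (- q * m * X * p ^ Suc n) p * qprod_inf (- q * m / X * p ^ Suc n) p))"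

lemma basis_inverse: "basis k (1 / X) = basis k X"
  by (simp add: basis_def mult_ac)

lemma basis_shift_0:
  assumes "X \<noteq> 0"
  shows "basis 0 (p * X) = (1 + m / (q * X)) * (1 + q * m / X) *
    (qprod_inf (- q * m * X * p) p * qprod_inf (- q * m / X * p) p)"
proof -
  have "qprod_inf (- q * m / (p * X)) p = (1 + m / (q * X)) * ((1 + q * m / X) * qprod_inf (- q * m / X * p) p)"
  proof -
    have "- q * m / (p * X) * p = - q * m / X" "1 - - q * m / (p * X) = 1 + m / (q * X)"
      "1 - - q * m / X = 1 + q * m / X"
      using assms q0 by (simp_all add: power2_eq_square)
    then show ?thesis
      using qprod_inf_Suc[OF p1, of "- q * m / (p * X)"] qprod_inf_Suc[OF p1, of "- q * m / X"]
      by (simp only:)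
  qed
  then show ?thesis by (simp add: basis_def mult_ac)
qed

text \<open>The shift moves the range of factors of the product in \<open>X\<close> up by one and
  that in \<open>1 / X\<close> down by one; this causes the division by \<open>1 - X\<close> and the
  factor \<open>1 - 1 / (p X)\<close>. The last two lines of the statement collect what the basis
  function has in common at \<open>p X\<close>, \<open>X / p\<close> and \<open>X\<close>, namely
  finite products of length \<open>k\<close> and infinite ones starting at
  \<open>k + 2\<close>.\<close>

lemma basis_shift_Suc:
  assumes "X \<noteq> 0" "X \<noteq> 1"
  shows "basis (Suc k) (p * X) = (1 - X * p ^ k) * (1 - X * p ^ Suc k) / (1 - X) * (1 - 1 / (p * X)) *
      ((1 + q * m * p ^ k / X) * (1 + q * m * p ^ Suc k / X)) *
    (qprod X p k * qprod (1 / X) p k *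
      (qprod_inf (- q * m * X * p ^ Suc (Suc k)) p * qprod_inf (- q * m / X * p ^ Suc (Suc k)) p))"
proof -
  have a: "qprod (p * X) p (Suc k) = qprod X p k * (1 - X * p ^ k) * (1 - X * p ^ Suc k) / (1 - X)"
    using qprod_shift[of X p "Suc k"] assms by (simp add: qprod_Suc field_simps)
  have b: "qprod (1 / (p * X)) p (Suc k) = (1 - 1 / (p * X)) * qprod (1 / X) p k"
    using q0 by (simp add: qprod_Suc')
  have c: "qprod_inf (- q * m / (p * X) * p ^ Suc k) p
      = (1 + q * m * p ^ k / X) * ((1 + q * m * p ^ Suc k / X) * qprod_inf (- q * m / X * p ^ Suc (Suc k)) p)"
    using qprod_inf_Suc[OF p1, of "- q * m / X * p ^ k"] qprod_inf_Suc[OF p1, of "- q * m / X * p ^ Suc k"] q0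
    by (simp add: mult_ac)
  have d: "- q * m * (p * X) * p ^ Suc k = - q * m * X * p ^ Suc (Suc k)"
    by (simp add: mult_ac)
  show ?thesis
    unfolding basis_def a b c d by (simp only: mult_ac times_divide_eq_left times_divide_eq_right)
qed

lemma basis_expand_Suc:
  shows "basis (Suc k) X = (1 - X * p ^ k) * (1 - p ^ k / X) *
      ((1 + q * m * p ^ Suc k * X) * (1 + q * m * p ^ Suc k / X)) *
    (qprod X p k * qprod (1 / X) p k *
      (qprod_inf (- q * m * X * p ^ Suc (Suc k)) p * qprod_inf (- q * m / X * p ^ Suc (Suc k)) p))"
proof -
  have c: "qprod_inf (- q * m * X * p ^ Suc k) p
      = (1 + q * m * p ^ Suc k * X) * qprod_inf (- q * m * X * p ^ Suc (Suc k)) p"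
    using qprod_inf_Suc[OF p1, of "- q * m * X * p ^ Suc k"] by (simp add: mult_ac)
  have d: "qprod_inf (- q * m / X * p ^ Suc k) p
      = (1 + q * m * p ^ Suc k / X) * qprod_inf (- q * m / X * p ^ Suc (Suc k)) p"
    using qprod_inf_Suc[OF p1, of "- q * m / X * p ^ Suc k"] by (simp add: mult_ac)
  show ?thesis
    unfolding basis_def c d by (simp add: qprod_Suc mult_ac)
qed

lemma factor_out:
  fixes a b k l P Q R E :: complex
  shows "a * (k * (P * E)) + b * (k * (Q * E)) - l * (k * (R * E)) = (a * P + b * Q - l * R) * (k * E)"
  by (simp only: ring_distribs mult_ac)

lemma telescope:
  assumes X: "X \<noteq> 0" "X \<noteq> 1"
  shows "(\<Sum>j<Suc n. q * X * summand j (p * X) + q / X * summand j (X / p) - (m + 1 / m) * summand j X) = remainder n X"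
proof (induction n)
  case 0
  define E where "E = qprod_inf (- q * m * X * p) p * qprod_inf (- q * m / X * p) p"
  have s: "basis 0 (p * X) = (1 + m / (q * X)) * (1 + q * m / X) * E"
    using basis_shift_0[OF X(1)] by (simp add: E_def)
  \<comment> \<open>By symmetry the backward shift at \<open>X\<close> is the forward shift at
    \<open>1 / X\<close>.\<close>
  have "basis 0 (X / p) = basis 0 (p * (1 / X))"
    using basis_inverse[of 0 "X / p"] by simp
  also have "\<dots> = (1 + m / q * X) * (1 + q * m * X) * E"
    using basis_shift_0[of "1 / X"] X by (simp add: E_def mult_ac)
  finally have t: "basis 0 (X / p) = (1 + m / q * X) * (1 + q * m * X) * E" .
  have u: "basis 0 X = (1 + q * m * X) * (1 + q * m / X) * E"
    using qprod_inf_Suc[OF p1, of "- q * m * X"] qprod_inf_Suc[OF p1, of "- q * m / X"]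
    by (simp add: basis_def E_def mult_ac)
  have r: "remainder 0 X = - ((1 + q * m) / m) * ((1 + m / q) * (1 - m\<^sup>2) * (1 - q * m)) * E"
    using num_Suc[of 0] by (simp add: remainder_def E_def num_def den_def)
  have "q * X * ((1 + m / (q * X)) * (1 + q * m / X)) + q / X * ((1 + m / q * X) * (1 + q * m * X))
      - (m + 1 / m) * ((1 + q * m * X) * (1 + q * m / X)) = - ((1 + q * m) / m) * ((1 - m\<^sup>2) * (1 - q * m))"
    by (rule difference_identity_0[OF q0 m0 X(1)])
  then have "(q * X * ((1 + m / (q * X)) * (1 + q * m / X)) + q / X * ((1 + m / q * X) * (1 + q * m * X))
      - (m + 1 / m) * ((1 + q * m * X) * (1 + q * m / X))) * ((1 + m / q) * E)
      = - ((1 + q * m) / m) * ((1 - m\<^sup>2) * (1 - q * m)) * ((1 + m / q) * E)"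
    by (rule arg_cong)
  moreover have s0: "summand 0 Y = (1 + m / q) * basis 0 Y" for Y
    by (simp add: summand_def coeff_def num_def den_def)
  have "(\<Sum>j<Suc 0. q * X * summand j (p * X) + q / X * summand j (X / p) - (m + 1 / m) * summand j X)
     = (q * X * ((1 + m / (q * X)) * (1 + q * m / X)) + q / X * ((1 + m / q * X) * (1 + q * m * X))
      - (m + 1 / m) * ((1 + q * m * X) * (1 + q * m / X))) * ((1 + m / q) * E)"
    by (simp only: sum.lessThan_Suc lessThan_0 sum.empty add_0_left s0 s t u factor_out)
  ultimately show ?case
    unfolding r by (simp only: mult_ac)
next
  case (Suc n)
  define w where "w = p ^ n"
  define y where "y = p * w"
  define E where "E = qprod X p n * qprod (1 / X) p n *
      (qprod_inf (- q * m * X * p ^ Suc (Suc n)) p * qprod_inf (- q * m / X * p ^ Suc (Suc n)) p)"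
  define c where "c = coeff (Suc n)"
  have yw: "p ^ n = w" "p ^ Suc n = y" by (simp_all add: w_def y_def)
  define A where "A = (1 - X * w) * (1 - w / X)"
  define B where "B = (1 + q * m * y * X) * (1 + q * m * y / X)"
  define P1 where "P1 = (1 - X * w) * (1 - X * y) / (1 - X) * (1 - 1 / (p * X)) * ((1 + q * m * w / X) * (1 + q * m * y / X))"
  define P2 where "P2 = (1 - w / X) * (1 - y / X) / (1 - 1 / X) * (1 - X / p) * ((1 + q * m * w * X) * (1 + q * m * y * X))"
  have s: "basis (Suc n) (p * X) = P1 * E"
    using basis_shift_Suc[OF X, of n] unfolding P1_def E_def yw .
  have "basis (Suc n) (X / p) = basis (Suc n) (p * (1 / X))"
    using basis_inverse[of "Suc n" "X / p"] by simp
  also have "\<dots> = P2 * E"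
    using basis_shift_Suc[of "1 / X" n] X unfolding P2_def E_def yw by (simp add: mult_ac)
  finally have t: "basis (Suc n) (X / p) = P2 * E" .
  have u: "basis (Suc n) X = A * B * E"
    using basis_expand_Suc[of n X] unfolding A_def B_def E_def yw .
  define D where "D = (1 - y) * (1 - q\<^sup>2 * w\<^sup>2) * (1 + w)"
  have d: "den (Suc n) = den n * D"
    unfolding den_Suc yw D_def ..
  then have "den n \<noteq> 0" "D \<noteq> 0"
    using den_nonzero[of "Suc n"] by auto
  \<comment> \<open>The prefactor of \<open>remainder n\<close> pairs \<open>num (Suc n)\<close>
    with \<open>den n\<close>. Restoring the missing factor \<open>D\<close> and one power of
    \<open>- q / m\<close> expresses it through the coefficient \<open>c\<close> of index
    \<open>Suc n\<close>, common to both remainders.\<close>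
  then have "num (Suc n) / den n * (- q / m) ^ n = - (m / q) * D * c"
    unfolding c_def coeff_def d power_Suc using q0 m0 by (simp add: field_simps)
  moreover have "qprod_inf (- q * m * X * p ^ Suc n) p * qprod_inf (- q * m / X * p ^ Suc n) p
     = B * (qprod_inf (- q * m * X * p ^ Suc (Suc n)) p * qprod_inf (- q * m / X * p ^ Suc (Suc n)) p)"
    using qprod_inf_Suc[OF p1, of "- q * m * X * p ^ Suc n"] qprod_inf_Suc[OF p1, of "- q * m / X * p ^ Suc n"]
    unfolding B_def yw[symmetric] by (simp add: mult_ac)
  moreover have "- ((1 + q * m) / m) * (- (m / q) * D * c) = (1 + q * m) / q * D * c"
    using m0 by simp
  ultimately have r0: "remainder n X = (1 + q * m) / q * D * B * (c * E)"
    unfolding remainder_def E_def by (simp only: mult_ac)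
  have "num (Suc (Suc n)) / den (Suc n) * (- q / m) ^ Suc n = (1 + m * y / q) * (1 - m\<^sup>2 * y\<^sup>2) * (1 - q * m * y) * c"
    unfolding num_Suc[of "Suc n"] yw c_def coeff_def by simp
  moreover have "qprod X p (Suc n) * qprod (1 / X) p (Suc n) = A * (qprod X p n * qprod (1 / X) p n)"
    unfolding A_def w_def by (simp add: qprod_Suc mult_ac)
  ultimately have r1: "remainder (Suc n) X
      = - ((1 + q * m) / m) * ((1 + m * y / q) * (1 - m\<^sup>2 * y\<^sup>2) * (1 - q * m * y)) * A * (c * E)"
    unfolding remainder_def E_def by (simp only: mult_ac)
  have "(1 + m * y\<^sup>2 / q) * (q * X * P1 + q / X * P2 - (m + 1 / m) * (A * B))
    = - ((1 + q * m) / m) * ((1 + m * y / q) * (1 - m\<^sup>2 * y\<^sup>2) * (1 - q * m * y)) * A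
     - (1 + q * m) / q * D * B"
    unfolding D_def A_def B_def P1_def P2_def by (rule difference_identity_Suc[OF q0 m0 X y_def])
  then have "(1 + m * y\<^sup>2 / q) * (q * X * P1 + q / X * P2 - (m + 1 / m) * (A * B)) * (c * E)
     = remainder (Suc n) X - remainder n X"
    unfolding r0 r1 by (simp only: left_diff_distrib)
  moreover have "summand (Suc n) Y = (1 + m * y\<^sup>2 / q) * c * basis (Suc n) Y" for Y
    unfolding summand_def c_def yw ..
  then have "q * X * summand (Suc n) (p * X) + q / X * summand (Suc n) (X / p) - (m + 1 / m) * summand (Suc n) X
      = (q * X * P1 + q / X * P2 - (m + 1 / m) * (A * B)) * ((1 + m * y\<^sup>2 / q) * c * E)"
    by (simp only: s t u factor_out)
  ultimately show ?case
    using Suc.IH unfolding sum.lessThan_Suc[of _ "Suc n"] by (simp only: mult_ac) simp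
qed

section \<open>Convergence and holomorphy of the series\<close>

abbreviation r :: real where "r \<equiv> norm q / norm m"

lemma r: "0 \<le> r" "r < 1"
  using qm m0 by (auto simp: divide_simps)

lemma num_tendsto:
  "num \<longlonglongrightarrow> qprod_inf (- m / q) p * qprod_inf m p * qprod_inf (- m) p * qprod_inf (q * m) p"
  unfolding num_def[abs_def] by (intro tendsto_intros qprod_tendsto p1)

lemma den_tendsto:
  "den \<longlonglongrightarrow> qprod_inf p p * qprod_inf (- q) p * qprod_inf q p * qprod_inf (- 1) p"
  unfolding den_def[abs_def] by (intro tendsto_intros qprod_tendsto p1)

lemma den_limit_nonzero: "qprod_inf p p * qprod_inf (- q) p * qprod_inf q p * qprod_inf (- 1) p \<noteq> 0"
proof -
  have "qprod_inf (- 1) p = 2 * qprod_inf (- p) p"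
    using qprod_inf_Suc[OF p1, of "- 1"] by simp
  then show ?thesis
    using qprod_inf_nonzero[OF p1, of p] qprod_inf_nonzero[OF p1, of "- p"]
      qprod_inf_nonzero[OF p1, of q] qprod_inf_nonzero[OF p1, of "- q"] p1 q1 by simp
qed

text \<open>Both quotients converge because the limit of \<open>den\<close> is nonzero. The first
  one enters \<open>summand\<close>, the second, with its index offset,
  \<open>remainder\<close>.\<close>

lemma coeff_bound:
  obtains C where "\<And>k. norm (num k / den k) \<le> C" "\<And>k. norm (num (Suc k) / den k) \<le> C"
proof -
  have "Bseq (\<lambda>k. num k / den k)"
    using tendsto_divide[OF num_tendsto den_tendsto den_limit_nonzero]
    by (intro convergent_imp_Bseq) (auto simp: convergent_def)
  then obtain C1 where C1: "\<And>k. norm (num k / den k) \<le> C1"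
    unfolding Bseq_def by blast
  have "Bseq (\<lambda>k. num (Suc k) / den k)"
    using tendsto_divide[OF LIMSEQ_Suc[OF num_tendsto] den_tendsto den_limit_nonzero]
    by (intro convergent_imp_Bseq) (auto simp: convergent_def)
  then obtain C2 where C2: "\<And>k. norm (num (Suc k) / den k) \<le> C2"
    unfolding Bseq_def by blast
  show ?thesis
    by (rule that[of "max C1 C2"]) (use C1 C2 in \<open>auto simp: le_max_iff_disj\<close>)
qed

lemma norm_mult_power_le: "norm (b * p ^ k) \<le> norm b"
  using p1 by (simp add: norm_mult norm_power mult_left_le power_le_one)

text \<open>The indices \<open>k\<close> and \<open>j\<close> are independent because
  \<open>basis k\<close> has \<open>j = k\<close> while \<open>remainder k\<close> has
  \<open>j = Suc k\<close>. Bounding both \<open>X\<close> and \<open>1 / X\<close> by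
  \<open>R\<close> keeps \<open>X\<close> in an annulus around the excluded point 0.\<close>

lemma norm_products_le:
  assumes "norm X \<le> R" "norm (1 / X) \<le> R"
  shows "norm (qprod X p k * qprod (1 / X) p k *
      (qprod_inf (- q * m * X * p ^ j) p * qprod_inf (- q * m / X * p ^ j) p))
    \<le> exp (R / (1 - norm p)) * exp (R / (1 - norm p)) *
      (exp (norm (q * m) * R / (1 - norm p)) * exp (norm (q * m) * R / (1 - norm p)))"
proof -
  have pp: "1 - norm p > 0" using p1 by simp
  have R: "R \<ge> 0" using assms(1) norm_ge_zero order_trans by blast
  have fin: "norm (qprod b p k) \<le> exp (R / (1 - norm p))" if "norm b \<le> R" for b
  proof -
    have "norm (qprod b p k) \<le> exp (norm b / (1 - norm p))"
      by (rule norm_qprod_le[OF p1])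
    also have "\<dots> \<le> exp (R / (1 - norm p))"
      using that pp by (simp add: divide_right_mono)
    finally show ?thesis .
  qed
  have inf: "norm (qprod_inf (- q * m * b * p ^ j) p) \<le> exp (norm (q * m) * R / (1 - norm p))" if "norm b \<le> R" for b
  proof -
    have "norm (qprod_inf (- q * m * b * p ^ j) p) \<le> exp (norm (- q * m * b * p ^ j) / (1 - norm p))"
      by (rule norm_qprod_inf_le[OF p1])
    also have "norm (- q * m * b * p ^ j) \<le> norm (q * m) * R"
      using norm_mult_power_le[of "- q * m * b" j] that
      by (simp add: norm_mult) (meson mult_left_mono norm_ge_zero order_trans mult_nonneg_nonneg)
    then have "exp (norm (- q * m * b * p ^ j) / (1 - norm p)) \<le> exp (norm (q * m) * R / (1 - norm p))"
      using pp by (subst exp_le_cancel_iff, intro divide_right_mono) auto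
    finally show ?thesis .
  qed
  have inf2: "norm (qprod_inf (- q * m / X * p ^ j) p) \<le> exp (norm (q * m) * R / (1 - norm p))"
    using inf[OF assms(2)] by simp
  have "norm (a * b * (c * d)) \<le> A * A * (B * B)"
    if "norm a \<le> A" "norm b \<le> A" "norm c \<le> B" "norm d \<le> B" for a b c d :: complex and A B
    unfolding norm_mult
    by (intro mult_mono that mult_nonneg_nonneg norm_ge_zero
        order_trans[OF norm_ge_zero that(1)] order_trans[OF norm_ge_zero that(3)])
  from this[OF fin[OF assms(1)] fin[OF assms(2)] inf[OF assms(1)] inf2] show ?thesis .
qed

lemma summand_bound:
  "\<exists>M. \<forall>k X. norm X \<le> R \<longrightarrow> norm (1 / X) \<le> R \<longrightarrow>
    norm (summand k X) \<le> M * r ^ k \<and> norm (remainder k X) \<le> M * r ^ k"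
proof -
  obtain C where C: "\<And>k. norm (num k / den k) \<le> C" "\<And>k. norm (num (Suc k) / den k) \<le> C"
    using coeff_bound by blast
  define K where "K = exp (R / (1 - norm p)) * exp (R / (1 - norm p)) *
      (exp (norm (q * m) * R / (1 - norm p)) * exp (norm (q * m) * R / (1 - norm p)))"
  define B where "B = max (1 + norm (m / q)) (norm (- ((1 + q * m) / m)))"
  have C0: "C \<ge> 0" using C(1)[of 0] norm_ge_zero order_trans by blast
  have K0: "K \<ge> 0" by (simp add: K_def)
  have B0: "B \<ge> 0" by (simp add: B_def le_max_iff_disj)
  have z: "norm ((- q / m) ^ k) = r ^ k" for k
    by (simp add: norm_power norm_divide)
  show ?thesis
  proof (intro exI[of _ "B * C * K"] allI impI conjI)
    fix k and X :: complex
    assume X: "norm X \<le> R" "norm (1 / X) \<le> R"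
    note * = norm_products_le[OF X, folded K_def]
    have "norm (1 + m * (p ^ k)\<^sup>2 / q) \<le> 1 + norm (m / q * p ^ (k * 2))"
      using norm_triangle_ineq[of 1 "m / q * p ^ (k * 2)"] by (simp add: power_mult)
    also have "\<dots> \<le> B"
      using norm_mult_power_le[of "m / q" "k * 2"] by (simp add: B_def)
    finally have b: "norm (1 + m * (p ^ k)\<^sup>2 / q) \<le> B" .
    have "norm (basis k X) \<le> K"
      using *[of k k] by (simp add: basis_def mult.assoc)
    then have "norm (summand k X) \<le> B * (C * r ^ k) * K"
      unfolding summand_def coeff_def norm_mult z
      by (intro mult_mono b C(1) z) (use C B0 C0 r in \<open>auto simp: norm_mult\<close>)
    then show "norm (summand k X) \<le> B * C * K * r ^ k"
      by (simp only: mult_ac)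
    have "norm (remainder k X) \<le> B * (C * r ^ k) * K"
      unfolding remainder_def norm_mult[of _ "qprod X p k * _ * _"] norm_mult[of "- ((1 + q * m) / m)"]
        norm_mult[of _ "(- q / m) ^ k"] z
      by (intro mult_mono C(2) *) (use B0 C0 r in \<open>auto simp: B_def\<close>)
    then show "norm (remainder k X) \<le> B * C * K * r ^ k"
      by (simp only: mult_ac)
  qed
qed

lemma summable_geometric_bound: "summable (\<lambda>k. M * r ^ k)"
  using r by (intro summable_mult summable_geometric) auto

lemma summable_summand: "summable (\<lambda>k. summand k X)"
proof -
  obtain M where M: "\<forall>k Y. norm Y \<le> max (norm X) (norm (1 / X)) \<longrightarrow> norm (1 / Y) \<le> max (norm X) (norm (1 / X)) \<longrightarrow>
      norm (summand k Y) \<le> M * r ^ k \<and> norm (remainder k Y) \<le> M * r ^ k"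
    using summand_bound by blast
  then have "norm (summand k X) \<le> M * r ^ k" for k
    by auto
  then show ?thesis
    by (rule summable_comparison_test'[OF summable_geometric_bound])
qed

lemma remainder_tendsto_0: "(\<lambda>k. remainder k X) \<longlonglongrightarrow> 0"
proof -
  obtain M where M: "\<forall>k Y. norm Y \<le> max (norm X) (norm (1 / X)) \<longrightarrow> norm (1 / Y) \<le> max (norm X) (norm (1 / X)) \<longrightarrow>
      norm (summand k Y) \<le> M * r ^ k \<and> norm (remainder k Y) \<le> M * r ^ k"
    using summand_bound by blast
  then have "norm (remainder k X) \<le> M * r ^ k" for k
    by auto
  then show ?thesis
    by (intro Lim_null_comparison[OF _ summable_LIMSEQ_zero[OF summable_geometric_bound]] always_eventually allI)
qed

lemma holomorphic_total: "total holomorphic_on - {0}"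
proof (rule holomorphic_uniform_sequence[where f = "\<lambda>n X. \<Sum>k<n. summand k X"])
  show "(\<lambda>X. \<Sum>k<n. summand k X) holomorphic_on - {0}" for n
    unfolding summand_def basis_def qprod_def by (intro holomorphic_intros p1) auto
  fix X :: complex assume "X \<in> - {0}"
  then have X: "norm X > 0" by simp
  \<comment> \<open>With this radius the disc lies in the annulus
    \<open>d \<le> |Y| \<le> 3 d\<close>, away from 0.\<close>
  define d where "d = norm X / 2"
  have d: "d > 0" using X by (simp add: d_def)
  have lower: "norm Y \<ge> d" if "Y \<in> cball X d" for Y
    using that norm_triangle_ineq2[of X Y] by (simp add: dist_norm d_def)
  have upper: "norm Y \<le> 3 * d" if "Y \<in> cball X d" for Y
    using that norm_triangle_ineq2[of Y X] by (simp add: dist_norm d_def norm_minus_commute)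
  obtain M where M: "\<forall>k Y. norm Y \<le> max (3 * d) (1 / d) \<longrightarrow> norm (1 / Y) \<le> max (3 * d) (1 / d) \<longrightarrow>
      norm (summand k Y) \<le> M * r ^ k \<and> norm (remainder k Y) \<le> M * r ^ k"
    using summand_bound by blast
  have "uniform_limit (cball X d) (\<lambda>n X. \<Sum>k<n. summand k X) (\<lambda>X. \<Sum>k. summand k X) sequentially"
  proof (rule Weierstrass_m_test[OF _ summable_geometric_bound])
    fix k Y assume Y: "Y \<in> cball X d"
    have "norm (1 / Y) \<le> 1 / d"
      using lower[OF Y] d by (simp add: norm_divide frac_le)
    then show "norm (summand k Y) \<le> M * r ^ k"
      using upper[OF Y] M by auto
  qed
  moreover have "cball X d \<subseteq> - {0}"
    using lower d by fastforce
  ultimately show "\<exists>d>0. cball X d \<subseteq> - {0} \<and>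
      uniform_limit (cball X d) (\<lambda>n X. \<Sum>k<n. summand k X) total sequentially"
    using d unfolding total_def[abs_def] by blast
qed auto

section \<open>The difference equation for the sum and its solution\<close>

lemma total_equation_generic:
  assumes "X \<noteq> 0" "X \<noteq> 1"
  shows "q * X * total (p * X) + q / X * total (X / p) = (m + 1 / m) * total X"
proof -
  have "(\<lambda>j. q * X * summand j (p * X) + q / X * summand j (X / p) - (m + 1 / m) * summand j X)
    sums (q * X * total (p * X) + q / X * total (X / p) - (m + 1 / m) * total X)"
    unfolding total_def by (intro sums_add sums_diff sums_mult summable_sums summable_summand)
  \<comment> \<open>By \<open>telescope\<close> the partial sums over \<open>Suc n\<close> terms are
    the remainders, so the value of the series is their limit, which is 0.\<close>
  then have "(\<lambda>n. remainder n X) \<longlonglongrightarrow> q * X * total (p * X) + q / X * total (X / p) - (m + 1 / m) * total X"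
    unfolding sums_def using LIMSEQ_Suc telescope[OF assms] by fastforce
  then show ?thesis
    using LIMSEQ_unique[OF remainder_tendsto_0] by fastforce
qed

lemma total_inverse: "total (1 / X) = total X"
  by (simp add: total_def summand_def basis_inverse)

lemma theta_equation_total:
  assumes P: "exp P = q\<^sup>2"
  shows "theta_equation q P (m + 1 / m) (\<lambda>z. total (exp z))"
proof
  show "q \<noteq> 0" by (rule q0)
  have "(total \<circ> exp) holomorphic_on UNIV"
    by (rule holomorphic_on_compose_gen[OF _ holomorphic_total]) (auto intro: holomorphic_intros)
  then show hol: "(\<lambda>z. total (exp z)) holomorphic_on UNIV"
    by (simp add: o_def)
  show "total (exp (z + 2 * of_real pi * \<i>)) = total (exp z)" for z
    by (simp only: exp_period)
  show "total (exp (- z)) = total (exp z)" for z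
    using total_inverse[of "exp z"] by (simp add: exp_minus inverse_eq_divide)
  define E where "E = (\<lambda>z. q * (exp z * total (exp (z + P))) + q * (exp (- z) * total (exp (z - P))) - (m + 1 / m) * total (exp z))"
  have generic: "E z = 0" if "exp z \<noteq> 1" for z
  proof -
    have e: "exp (z + P) = p * exp z" "exp (z - P) = exp z / p" "exp (- z) = 1 / exp z"
      by (simp_all add: exp_add exp_diff exp_minus P inverse_eq_divide)
    show ?thesis
      using total_equation_generic[of "exp z"] that by (simp add: E_def e mult.assoc)
  qed
  have cont: "continuous_on UNIV (\<lambda>z. total (exp z))"
    using hol by (rule holomorphic_on_imp_continuous_on)
  have "continuous_on UNIV (\<lambda>z. total (exp (z + P)))" "continuous_on UNIV (\<lambda>z. total (exp (z - P)))"
    by (rule continuous_on_compose2[OF cont]; auto intro!: continuous_intros)+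
  then have contE: "continuous_on UNIV E"
    unfolding E_def by (intro continuous_intros cont)
  have "E z = 0" for z
  proof (cases "exp z = 1")
    case True
    \<comment> \<open>The telescoping divides by \<open>1 - X\<close>, which leaves out
      \<open>X = 1\<close>. Real displacements of \<open>z\<close> avoid this value, and continuity
      of \<open>E\<close> recovers it in the limit.\<close>
    have "(\<lambda>n. E (z + of_real (inverse (real (Suc n))))) \<longlonglongrightarrow> E (z + of_real 0)"
      by (intro isCont_tendsto_compose[where g = E] tendsto_intros LIMSEQ_inverse_real_of_nat)
        (use contE in \<open>simp add: continuous_on_eq_continuous_at\<close>)
    moreover have "E (z + of_real (inverse (real (Suc n)))) = 0" for n
    proof (rule generic)
      have "exp (z + of_real (inverse (real (Suc n)))) = of_real (exp (inverse (real (Suc n))))"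
        unfolding exp_add True exp_of_real by simp
      also have "\<dots> \<noteq> 1"
        by (subst of_real_eq_1_iff) simp
      finally show "exp (z + of_real (inverse (real (Suc n)))) \<noteq> 1" .
    qed
    ultimately have "(\<lambda>n. 0) \<longlonglongrightarrow> E z" by simp
    then show ?thesis by (simp add: LIMSEQ_const_iff)
  qed (rule generic)
  then show "q * (exp z * total (exp (z + P))) + q * (exp (- z) * total (exp (z - P))) = (m + 1 / m) * total (exp z)" for z
    by (simp add: E_def)
qed

lemma total_1: "total 1 = (1 + m / q) * (qprod_inf (- q * m) p)\<^sup>2"
proof -
  have "summand (Suc j) 1 = 0" for j
    by (simp add: summand_def basis_def qprod_Suc')
  then have "summand k 1 = 0" if "k \<noteq> 0" for k
    using not0_implies_Suc[OF that] by auto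
  then have "total 1 = summand 0 1"
    unfolding total_def by (subst suminf_finite[of "{0}"]) auto
  then show ?thesis
    by (simp add: summand_def basis_def coeff_def num_def den_def power2_eq_square)
qed

text \<open>Uniqueness is applied with second point 0, that is \<open>X = 1\<close>, where the theta
  sum equals \<open>2 * theta_mult q m\<close>. This number may vanish for large \<open>m\<close>,
  so it stays on the left as a factor.\<close>

theorem total_eq:
  assumes X: "X \<noteq> 0"
  shows "2 * theta_mult q m * total X
    = (1 + m / q) * (qprod_inf (- q * m) p)\<^sup>2 * (theta_mult q (m * X) + theta_mult q (m / X))"
proof -
  obtain P where P: "exp P = p"
    using exp_Ln[of p] q0 by (metis power_eq_0_iff)
  obtain z where z: "exp z = X"
    using exp_Ln[OF X] by blast
  from theta_equation_unique[OF theta_equation_total[OF P] theta_equation_theta[OF q1 q0 m0 P], of z 0]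
  have "total X * (theta_mult q m + theta_mult q m)
      = ((1 + m / q) * (qprod_inf (- q * m) p)\<^sup>2) * (theta_mult q (m * X) + theta_mult q (m * (1 / X)))"
    by (simp only: z exp_zero minus_zero mult_1_right total_1 exp_minus inverse_eq_divide)
  then show ?thesis by (simp add: mult_ac)
qed

section \<open>From the sum without denominators in \<open>X\<close> back to
  \<open>W87\<close>\<close>

lemma W87_lower_params:
  "[p, p * (- m / q) / X, p * (- m / q) / (1 / X), p * (- m / q) / m, p * (- m / q) / (- m),
    p * (- m / q) / (q * m)] = [p, - q * m / X, - q * m * X, - q, q, - 1]"
  using q0 m0 by (simp add: power2_eq_square)

text \<open>Splitting each infinite product after \<open>k\<close> factors cancels the lower
  parameters that depend on \<open>X\<close> in the term of index \<open>k\<close>. Regularity makes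
  all finite products nonzero; the infinite ones are then nonzero as well, since a convergent
  product vanishes only through one of its factors.\<close>

lemma W87_eq:
  assumes X: "X \<noteq> 0" and reg: "W87_regular (- m / q) X (1 / X) m (- m) (q * m) p"
  shows "W87 (- m / q) X (1 / X) m (- m) (q * m) p (- q / m) *
     ((1 + m / q) * (qprod_inf (- q * m * X) p * qprod_inf (- q * m / X) p)) = total X"
    and "qprod_inf (- q * m * X) p \<noteq> 0" "qprod_inf (- q * m / X) p \<noteq> 0" "1 + m / q \<noteq> 0"
proof -
  have nz: "qprod (- q * m / X) p k \<noteq> 0" "qprod (- q * m * X) p k \<noteq> 0" for k
    using reg unfolding W87_regular_def W87_lower_params qpoch_eq by auto
  then show K: "qprod_inf (- q * m * X) p \<noteq> 0" "qprod_inf (- q * m / X) p \<noteq> 0"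
    unfolding qprod_inf_eq_0_iff[OF p1] qprod_eq_0_iff by blast+
  show u: "1 + m / q \<noteq> 0"
  proof
    assume "1 + m / q = 0"
    then have "m / q = - 1" by (simp add: add_eq_0_iff)
    moreover have "- m / q \<noteq> 1" using reg unfolding W87_regular_def by blast
    ultimately show False by simp
  qed
  define c where "c = (1 + m / q) * (qprod_inf (- q * m * X) p * qprod_inf (- q * m / X) p)"
  have c: "c \<noteq> 0" using K u by (simp add: c_def)
  have "W87 (- m / q) X (1 / X) m (- m) (q * m) p (- q / m) = (\<Sum>k. summand k X / c)"
    unfolding W87_def
  proof (rule suminf_cong)
    fix k
    have pk: "p ^ (2 * k) = (p ^ k)\<^sup>2"
      by (simp add: power_mult mult.commute[of 2])
    have s: "qprod_inf (- q * m * X) p = qprod (- q * m * X) p k * qprod_inf (- q * m * X * p ^ k) p"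
       "qprod_inf (- q * m / X) p = qprod (- q * m / X) p k * qprod_inf (- q * m / X * p ^ k) p"
      by (rule qprod_inf_split[OF p1])+
    have fr: "v * N * z / (u * (d * (a * b))) = v * (N' / d * z) * (N'' * A * B) / (u * (b * A * (a * B)))"
      if "N = N' * N''" "A \<noteq> 0" "B \<noteq> 0" for v N z u d a b N' N'' A B :: complex
      using that by (simp add: field_simps)
    have nz': "qprod_inf (- q * m * X * p ^ k) p \<noteq> 0" "qprod_inf (- q * m / X * p ^ k) p \<noteq> 0"
      using K s by auto
    have "(1 - - m / q * p ^ (2 * k)) * qpoch [- m / q, X, 1 / X, m, - m, q * m] p k * (- q / m) ^ k /
       ((1 - - m / q) * qpoch [p, p * (- m / q) / X, p * (- m / q) / (1 / X), p * (- m / q) / m,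
          p * (- m / q) / (- m), p * (- m / q) / (q * m)] p k)
      = (1 + m * (p ^ k)\<^sup>2 / q) * (num k * (qprod X p k * qprod (1 / X) p k)) * (- q / m) ^ k /
       ((1 + m / q) * (den k * (qprod (- q * m / X) p k * qprod (- q * m * X) p k)))"
      unfolding W87_lower_params qpoch_eq pk num_def den_def by (simp add: mult_ac)
    also have "\<dots> = summand k X / c"
      unfolding summand_def basis_def coeff_def c_def s by (rule fr[OF refl nz'])
    finally show "(1 - - m / q * p ^ (2 * k)) * qpoch [- m / q, X, 1 / X, m, - m, q * m] p k * (- q / m) ^ k /
       ((1 - - m / q) * qpoch [p, p * (- m / q) / X, p * (- m / q) / (1 / X), p * (- m / q) / m,
          p * (- m / q) / (- m), p * (- m / q) / (q * m)] p k) = summand k X / c" .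
  qed
  also have "\<dots> = total X / c"
    unfolding total_def by (rule suminf_divide[OF summable_summand])
  finally show "W87 (- m / q) X (1 / X) m (- m) (q * m) p (- q / m) *
     ((1 + m / q) * (qprod_inf (- q * m * X) p * qprod_inf (- q * m / X) p)) = total X"
    using c unfolding c_def[symmetric] by simp
qed

end

section \<open>Meromorphic functions of two variables\<close>

lemma holomorphic2_on_imp_continuous_on: "holomorphic2_on f U \<Longrightarrow> continuous_on U f"
  unfolding holomorphic2_on_def
  by (intro continuous_at_imp_continuous_on ballI) (blast dest: has_derivative_continuous)

lemma holomorphic2_on_subset: "holomorphic2_on f U \<Longrightarrow> V \<subseteq> U \<Longrightarrow> holomorphic2_on f V"
  unfolding holomorphic2_on_def by blast

lemma holomorphic2_on_const: "holomorphic2_on (\<lambda>z. c) U"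
proof -
  have "(\<lambda>(v :: complex, w :: complex). 0 * v + 0 * w) = (\<lambda>_. 0)" by auto
  then have "((\<lambda>z. c) has_derivative (\<lambda>(v, w). 0 * v + 0 * w)) (at z)" for z :: "complex \<times> complex"
    by simp
  then show ?thesis unfolding holomorphic2_on_def by blast
qed

lemma holomorphic2_on_mult:
  assumes "holomorphic2_on f U" "holomorphic2_on g U"
  shows "holomorphic2_on (\<lambda>z. f z * g z) U"
  unfolding holomorphic2_on_def
proof
  fix z assume "z \<in> U"
  obtain a b where f: "(f has_derivative (\<lambda>(v, w). a * v + b * w)) (at z)"
    using assms(1) \<open>z \<in> U\<close> unfolding holomorphic2_on_def by blast
  obtain c d where g: "(g has_derivative (\<lambda>(v, w). c * v + d * w)) (at z)"
    using assms(2) \<open>z \<in> U\<close> unfolding holomorphic2_on_def by blast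
  from has_derivative_mult[OF f g]
  have "((\<lambda>z. f z * g z) has_derivative (\<lambda>(v, w). (f z * c + a * g z) * v + (f z * d + b * g z) * w)) (at z)"
    by (rule has_derivative_eq_rhs) (auto simp: algebra_simps)
  then show "\<exists>a b. ((\<lambda>z. f z * g z) has_derivative (\<lambda>(v, w). a * v + b * w)) (at z)"
    by blast
qed

lemma holomorphic2_on_add:
  assumes "holomorphic2_on f U" "holomorphic2_on g U"
  shows "holomorphic2_on (\<lambda>z. f z + g z) U"
  unfolding holomorphic2_on_def
proof
  fix z assume "z \<in> U"
  obtain a b where f: "(f has_derivative (\<lambda>(v, w). a * v + b * w)) (at z)"
    using assms(1) \<open>z \<in> U\<close> unfolding holomorphic2_on_def by blast
  obtain c d where g: "(g has_derivative (\<lambda>(v, w). c * v + d * w)) (at z)"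
    using assms(2) \<open>z \<in> U\<close> unfolding holomorphic2_on_def by blast
  from has_derivative_add[OF f g]
  have "((\<lambda>z. f z + g z) has_derivative (\<lambda>(v, w). (a + c) * v + (b + d) * w)) (at z)"
    by (rule has_derivative_eq_rhs) (auto simp: algebra_simps)
  then show "\<exists>a b. ((\<lambda>z. f z + g z) has_derivative (\<lambda>(v, w). a * v + b * w)) (at z)"
    by blast
qed

lemma holomorphic2_on_diff:
  assumes "holomorphic2_on f U" "holomorphic2_on g U"
  shows "holomorphic2_on (\<lambda>z. f z - g z) U"
  using holomorphic2_on_add[OF assms(1) holomorphic2_on_mult[OF holomorphic2_on_const assms(2)], of "- 1"]
  by simp

lemma holomorphic2_on_entire_linear:
  assumes "f holomorphic_on UNIV"
  shows "holomorphic2_on (\<lambda>z. f (a * fst z + b * snd z)) U"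
  unfolding holomorphic2_on_def
proof
  fix z :: "complex \<times> complex"
  let ?l = "\<lambda>z. a * fst z + b * snd z"
  have f: "(f has_derivative (*) (deriv f (?l z))) (at (?l z))"
    using holomorphic_derivI[OF assms open_UNIV UNIV_I] by (rule has_field_derivative_imp_has_derivative)
  have "(?l has_derivative ?l) (at z)"
    by (intro derivative_eq_intros) auto
  from has_derivative_compose[OF this f]
  have "((\<lambda>z. f (?l z)) has_derivative
      (\<lambda>(v, w). deriv f (?l z) * a * v + deriv f (?l z) * b * w)) (at z)"
    by (rule has_derivative_eq_rhs) (auto simp: algebra_simps)
  then show "\<exists>c d. ((\<lambda>z. f (?l z)) has_derivative (\<lambda>(v, w). c * v + d * w)) (at z)"
    by blast
qed

text \<open>Reduction to one variable: restrict to the complex line through \<open>z\<close> and a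
  point of \<open>V\<close>. Convexity of \<open>U\<close> makes its trace on that line convex,
  hence connected, so the one-variable identity theorem applies.\<close>

lemma holomorphic2_identity:
  assumes h: "holomorphic2_on h U" and U: "open U" "convex U"
    and V: "open V" "V \<noteq> {}" "V \<subseteq> U" and zero: "\<And>z. z \<in> V \<Longrightarrow> h z = 0"
    and z: "z \<in> U"
  shows "h z = 0"
proof -
  obtain y where y: "y \<in> V" using V by blast
  define \<gamma> where "\<gamma> = (\<lambda>t::complex. (fst y + t * (fst z - fst y), snd y + t * (snd z - snd y)))"
  have cont: "continuous_on UNIV \<gamma>"
    unfolding \<gamma>_def by (intro continuous_intros)
  have \<gamma>01: "\<gamma> 0 = y" "\<gamma> 1 = z" by (simp_all add: \<gamma>_def)
  have opens: "open (\<gamma> -` U)" "open (\<gamma> -` V)"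
    using open_vimage[OF U(1) cont] open_vimage[OF V(1) cont] .
  have "convex (\<gamma> -` U)"
  proof (rule convexI)
    fix s t :: complex and u v :: real
    assume st: "s \<in> \<gamma> -` U" "t \<in> \<gamma> -` U" and uv: "0 \<le> u" "0 \<le> v" "u + v = 1"
    have "\<gamma> (u *\<^sub>R s + v *\<^sub>R t) = u *\<^sub>R \<gamma> s + v *\<^sub>R \<gamma> t"
    proof -
      have "a + (u *\<^sub>R s + v *\<^sub>R t) * d = u *\<^sub>R (a + s * d) + v *\<^sub>R (a + t * d)" for a d :: complex
      proof -
        have "u *\<^sub>R (a + s * d) + v *\<^sub>R (a + t * d) = (u + v) *\<^sub>R a + (u *\<^sub>R s + v *\<^sub>R t) * d"
          by (simp add: algebra_simps)
        then show ?thesis by (simp add: uv)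
      qed
      then show ?thesis by (simp add: \<gamma>_def)
    qed
    then show "u *\<^sub>R s + v *\<^sub>R t \<in> \<gamma> -` U"
      using convexD[OF U(2)] st uv by simp
  qed
  then have conn: "connected (\<gamma> -` U)" by (rule convex_connected)
  have hol: "(\<lambda>t. h (\<gamma> t)) holomorphic_on \<gamma> -` U"
    unfolding holomorphic_on_open[OF opens(1)]
  proof
    fix t assume "t \<in> \<gamma> -` U"
    then have "\<gamma> t \<in> U" by simp
    then obtain a b where h': "(h has_derivative (\<lambda>(v, w). a * v + b * w)) (at (\<gamma> t))"
      using h unfolding holomorphic2_on_def by blast
    have "(\<gamma> has_derivative (\<lambda>s. (s * (fst z - fst y), s * (snd z - snd y)))) (at t)"
      unfolding \<gamma>_def by (rule derivative_eq_intros refl)+ simp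
    from has_derivative_compose[OF this h']
    have "((\<lambda>t. h (\<gamma> t)) has_derivative (*) (a * (fst z - fst y) + b * (snd z - snd y))) (at t)"
      by (rule has_derivative_eq_rhs) (auto simp: algebra_simps)
    then show "\<exists>D. ((\<lambda>t. h (\<gamma> t)) has_field_derivative D) (at t)"
      unfolding has_field_derivative_def by blast
  qed
  have "h (\<gamma> 1) = 0"
  proof (rule analytic_continuation_open[OF opens(2) opens(1) _ conn _ hol, of "\<lambda>_. 0"])
    show "\<gamma> -` V \<noteq> {}" using y \<gamma>01(1) by (metis empty_iff vimageI)
    show "\<gamma> -` V \<subseteq> \<gamma> -` U" using V by auto
    show "1 \<in> \<gamma> -` U" using z \<gamma>01 by simp
  qed (use zero in auto)
  then show ?thesis by (simp add: \<gamma>01)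
qed

text \<open>It is stated for an arbitrary open \<open>W\<close> so that it can be iterated: applied
  to the nonzero set of one denominator, it yields points where a second one does not vanish
  either.\<close>

lemma dense_nonzero_open:
  assumes "open W" "W \<noteq> {}" "W \<subseteq> U" "U \<subseteq> closure {z \<in> U. h z \<noteq> 0}" "continuous_on U h"
  shows "open {z \<in> W. h z \<noteq> (0::complex)}" "{z \<in> W. h z \<noteq> 0} \<noteq> {}"
proof -
  have "continuous_on W h"
    using assms continuous_on_subset by blast
  from continuous_open_preimage[OF this \<open>open W\<close>, of "- {0}"]
  have "open (W \<inter> h -` (- {0}))" by (simp add: open_Compl)
  then show "open {z \<in> W. h z \<noteq> 0}"
    by (simp add: vimage_def Int_def)
  obtain w where "w \<in> W" using assms by blast
  then have "W \<inter> closure {z \<in> U. h z \<noteq> 0} \<noteq> {}" using assms by blast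
  then have "W \<inter> {z \<in> U. h z \<noteq> 0} \<noteq> {}"
    using open_Int_closure_eq_empty[OF \<open>open W\<close>] by blast
  then show "{z \<in> W. h z \<noteq> 0} \<noteq> {}" by blast
qed

lemma meromorphic2E:
  assumes "meromorphic2 F"
  obtains U g h where "open U" "z0 \<in> U" "holomorphic2_on g U" "holomorphic2_on h U"
    "U \<subseteq> closure {z \<in> U. h z \<noteq> 0}" "\<And>z. z \<in> U \<Longrightarrow> h z \<noteq> 0 \<Longrightarrow> F z = g z / h z"
proof -
  from spec[OF assms[unfolded meromorphic2_def], of z0] show thesis
  proof (elim exE conjE)
    fix U g h
    assume "open U" "z0 \<in> U" "holomorphic2_on g U" "holomorphic2_on h U"
      "U \<subseteq> closure {z \<in> U. h z \<noteq> 0}" and eq: "\<forall>z\<in>U. h z \<noteq> 0 \<longrightarrow> F z = g z / h z"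
    then show thesis
      by (intro that[of U g h]) (use eq in simp_all)
  qed
qed

text \<open>The closure of the interior \<open>A\<close> of the set of agreement is shown to be
  open. Near a point of that closure both functions are quotients on a common ball; the
  cross-multiplied difference \<open>d\<close> vanishes on an open part of the ball, hence on all of
  it, so the functions agree wherever neither denominator vanishes. The interior is used because
  values at zeros of the denominators are arbitrary.\<close>

theorem meromorphic2_eqI:
  assumes F: "meromorphic2 F" and G: "meromorphic2 G"
    and W: "open W" "W \<noteq> {}" "\<And>z. z \<in> W \<Longrightarrow> F z = G z"
  shows "meromorphic2_eq F G"
proof -
  define A where "A = interior {z. F z = G z}"
  have A: "open A" "\<And>z. z \<in> A \<Longrightarrow> F z = G z"
    using interior_subset[of "{z. F z = G z}"] by (auto simp: A_def)
  have AI: "V \<subseteq> A" if "open V" "\<And>z. z \<in> V \<Longrightarrow> F z = G z" for V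
    unfolding A_def using that by (intro interior_maximal) auto
  have "open (closure A)"
    unfolding open_subopen[of "closure A"]
  proof
    fix z0 assume z0: "z0 \<in> closure A"
    obtain U1 g1 h1 where 1: "open U1" "z0 \<in> U1" "holomorphic2_on g1 U1" "holomorphic2_on h1 U1"
       "U1 \<subseteq> closure {z \<in> U1. h1 z \<noteq> 0}" "\<And>z. z \<in> U1 \<Longrightarrow> h1 z \<noteq> 0 \<Longrightarrow> F z = g1 z / h1 z"
      by (rule meromorphic2E[OF F, of z0]) (rule that; assumption)
    obtain U2 g2 h2 where 2: "open U2" "z0 \<in> U2" "holomorphic2_on g2 U2" "holomorphic2_on h2 U2"
       "U2 \<subseteq> closure {z \<in> U2. h2 z \<noteq> 0}" "\<And>z. z \<in> U2 \<Longrightarrow> h2 z \<noteq> 0 \<Longrightarrow> G z = g2 z / h2 z"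
      by (rule meromorphic2E[OF G, of z0]) (rule that; assumption)
    obtain e where e: "e > 0" "ball z0 e \<subseteq> U1 \<inter> U2"
      using 1(1,2) 2(1,2) openE[of "U1 \<inter> U2" z0] by blast
    define B where "B = ball z0 e"
    have B: "open B" "convex B" "z0 \<in> B" "B \<subseteq> U1" "B \<subseteq> U2"
      using e by (auto simp: B_def)
    have nonzero: "open {z \<in> V. h1 z \<noteq> 0 \<and> h2 z \<noteq> 0}" "{z \<in> V. h1 z \<noteq> 0 \<and> h2 z \<noteq> 0} \<noteq> {}"
      if V: "open V" "V \<noteq> {}" "V \<subseteq> B" for V
    proof -
      have "V \<subseteq> U1" using V B by blast
      note V1 = dense_nonzero_open[OF V(1,2) this 1(5) holomorphic2_on_imp_continuous_on[OF 1(4)]]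
      have "{z \<in> V. h1 z \<noteq> 0} \<subseteq> U2" using V B by blast
      note V2 = dense_nonzero_open[OF V1 this 2(5) holomorphic2_on_imp_continuous_on[OF 2(4)]]
      show "open {z \<in> V. h1 z \<noteq> 0 \<and> h2 z \<noteq> 0}" "{z \<in> V. h1 z \<noteq> 0 \<and> h2 z \<noteq> 0} \<noteq> {}"
        using V2 by (simp_all add: conj_assoc)
    qed
    define d where "d = (\<lambda>z. g1 z * h2 z - g2 z * h1 z)"
    have hold: "holomorphic2_on d B"
      unfolding d_def
      by (intro holomorphic2_on_diff holomorphic2_on_mult holomorphic2_on_subset[OF 1(3) B(4)]
          holomorphic2_on_subset[OF 1(4) B(4)] holomorphic2_on_subset[OF 2(3) B(5)]
          holomorphic2_on_subset[OF 2(4) B(5)])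
    have "B \<inter> A \<noteq> {}"
      using z0 B(3) open_Int_closure_eq_empty[OF B(1), of A] by blast
    then have AB: "open (A \<inter> B)" "A \<inter> B \<noteq> {}" "A \<inter> B \<subseteq> B"
      using A B by auto
    have d0: "d z = 0" if "z \<in> B" for z
    proof (rule holomorphic2_identity[OF hold B(1,2) nonzero[OF AB] _ _ that])
      fix y assume y: "y \<in> {z \<in> A \<inter> B. h1 z \<noteq> 0 \<and> h2 z \<noteq> 0}"
      then have "y \<in> U1" "y \<in> U2" using B by auto
      with y have "g1 y / h1 y = g2 y / h2 y"
        using A(2)[of y] 1(6)[of y] 2(6)[of y] by simp
      then show "d y = 0" using y by (simp add: d_def field_simps)
    qed auto
    have eq: "F z = G z" if "z \<in> B" "h1 z \<noteq> 0" "h2 z \<noteq> 0" for z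
    proof -
      have "F z = g1 z / h1 z" "G z = g2 z / h2 z"
        using 1(6)[of z] 2(6)[of z] subsetD[OF B(4) that(1)] subsetD[OF B(5) that(1)] that by simp_all
      moreover have "g1 z / h1 z = g2 z / h2 z"
        using d0[OF that(1)] that by (simp add: d_def frac_eq_eq)
      ultimately show ?thesis by simp
    qed
    have "B \<subseteq> closure A"
    proof (rule ccontr)
      assume "\<not> B \<subseteq> closure A"
      then have V: "open (B - closure A)" "B - closure A \<noteq> {}" "B - closure A \<subseteq> B"
        using B by auto
      have "{z \<in> B - closure A. h1 z \<noteq> 0 \<and> h2 z \<noteq> 0} \<subseteq> A"
        by (rule AI[OF nonzero(1)[OF V]]) (use eq in auto)
      then show False
        using nonzero(2)[OF V] closure_subset[of A] by blast
    qed
    then show "\<exists>T. open T \<and> z0 \<in> T \<and> T \<subseteq> closure A"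
      using B by blast
  qed
  moreover have "W \<subseteq> A" by (rule AI[OF W(1,3)])
  then have "closure A \<noteq> {}" using W(2) closure_subset[of A] by blast
  ultimately have "closure A = UNIV"
    using clopen[of "closure A"] by auto
  then show ?thesis
    unfolding meromorphic2_eq_def using F G A by blast
qed

lemma entire_dense_nonzero:
  assumes "f holomorphic_on UNIV" "f a \<noteq> 0"
  shows "closure {z. f z \<noteq> 0} = UNIV"
proof (rule ccontr)
  define V where "V = - closure {z. f z \<noteq> 0}"
  assume "closure {z. f z \<noteq> 0} \<noteq> UNIV"
  then have "V \<noteq> {}" unfolding V_def by blast
  have "open V" unfolding V_def by (intro open_Compl closed_closure)
  have zero: "f z = 0" if "z \<in> V" for z
    using that closure_subset[of "{z. f z \<noteq> 0}"] by (auto simp: V_def)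
  have "f a = (\<lambda>_. 0) a"
    by (rule analytic_continuation_open[OF \<open>open V\<close> open_UNIV \<open>V \<noteq> {}\<close> connected_UNIV
          subset_UNIV assms(1) holomorphic_on_const _ UNIV_I]) (rule zero)
  with assms show False by simp
qed

section \<open>The Askey-Wilson function\<close>

lemma qpow_add: "qpow \<tau> (u + v) = qpow \<tau> u * qpow \<tau> v"
  by (simp add: qpow_def exp_add[symmetric] algebra_simps)

lemma qpow_diff: "qpow \<tau> (u - v) = qpow \<tau> u / qpow \<tau> v"
  by (simp add: qpow_def exp_diff[symmetric] algebra_simps)

lemma qpow_minus: "qpow \<tau> (- u) = 1 / qpow \<tau> u"
  using qpow_diff[of \<tau> 0 u] by (simp add: qpow_def)

lemma qpow_0 [simp]: "qpow \<tau> 0 = 1"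
  by (simp add: qpow_def)

lemma qpow_nonzero [simp]: "qpow \<tau> u \<noteq> 0"
  by (simp add: qpow_def)

lemma qpow_2: "qpow \<tau> 2 = (qpow \<tau> 1)\<^sup>2"
  using qpow_add[of \<tau> 1 1] by (simp add: power2_eq_square)

lemma qpow_half_period: "\<tau> \<noteq> 0 \<Longrightarrow> qpow \<tau> (1 / (2 * \<tau>)) = - 1"
  using exp_pi_i by (simp add: qpow_def)

lemma holomorphic_qpow [holomorphic_intros]:
  "f holomorphic_on A \<Longrightarrow> (\<lambda>z. qpow \<tau> (f z)) holomorphic_on A"
  unfolding qpow_def by (intro holomorphic_intros)

section \<open>The special self-dual parameters\<close>

locale self_dual_parameters =
  fixes \<tau> :: complex
  assumes Im_tau: "Im \<tau> > 0"
begin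

definition q :: complex where "q = qpow \<tau> 1"

lemma tau_nonzero: "\<tau> \<noteq> 0"
  using Im_tau by auto

lemma q_nonzero: "q \<noteq> 0"
  by (simp add: q_def)

lemma norm_q: "norm q < 1"
proof -
  have "Re (2 * of_real pi * \<i> * \<tau> * 1) < 0"
    using Im_tau by simp
  then show ?thesis by (simp add: q_def qpow_def)
qed

lemma qpow_2_eq: "qpow \<tau> 2 = q\<^sup>2"
  by (simp add: q_def qpow_2)

lemma vtheta_eq: "vtheta \<tau> x = theta_mult q (qpow \<tau> x)"
  by (simp add: vtheta_def theta_mult_def qpoch_inf_simps qpow_2_eq qpow_add qpow_diff q_def)

lemma holomorphic_vtheta: "vtheta \<tau> holomorphic_on UNIV"
  unfolding vtheta_eq[abs_def] by (intro holomorphic_intros norm_q) auto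

lemma vtheta_0_nonzero: "vtheta \<tau> 0 \<noteq> 0"
  using norm_q qprod_inf_nonzero[OF norm_power2_less_1[OF norm_q], of "- q"]
  by (simp add: vtheta_eq theta_mult_def)

abbreviation numerator :: "complex \<times> complex \<Rightarrow> complex"
  where "numerator z \<equiv> qpoch_inf [- qpow \<tau> 1, - qpow \<tau> 1] (qpow \<tau> 2) / 2 *
    (vtheta \<tau> (fst z + snd z) + vtheta \<tau> (fst z - snd z))"

abbreviation denominator :: "complex \<times> complex \<Rightarrow> complex"
  where "denominator z \<equiv> vtheta \<tau> (fst z) * vtheta \<tau> (snd z)"

text \<open>Numerator and denominator are entire, so one global quotient serves at every point. The
  denominator separates the variables: its nonzero set is a product of two sets, each dense because
  \<open>vtheta\<close> does not vanish at 0.\<close>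

lemma meromorphic2_theta_quotient: "meromorphic2 (\<lambda>z. numerator z / denominator z)"
proof -
  have hol: "holomorphic2_on (\<lambda>z. vtheta \<tau> (a * fst z + b * snd z)) UNIV" for a b
    by (rule holomorphic2_on_entire_linear[OF holomorphic_vtheta])
  have N: "holomorphic2_on numerator UNIV"
    using hol[of 1 1] hol[of 1 "- 1"]
    by (intro holomorphic2_on_mult holomorphic2_on_add holomorphic2_on_const) simp_all
  have D: "holomorphic2_on denominator UNIV"
    using hol[of 1 0] hol[of 0 1] by (intro holomorphic2_on_mult) simp_all
  have "{z. denominator z \<noteq> 0} = {x. vtheta \<tau> x \<noteq> 0} \<times> {x. vtheta \<tau> x \<noteq> 0}"
    by auto
  then have "closure {z. denominator z \<noteq> 0} = UNIV"
    using entire_dense_nonzero[OF holomorphic_vtheta vtheta_0_nonzero] by (simp add: closure_Times)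
  with N D show ?thesis
    unfolding meromorphic2_def
    by (intro allI exI[of _ UNIV] exI[of _ numerator] exI[of _ denominator]) simp
qed

abbreviation (input) b0 :: complex where "b0 \<equiv> 1 / (2 * \<tau>)"

lemma dual_params:
  "dual_a 0 b0 1 (1 - b0) = 0" "dual_b 0 b0 1 (1 - b0) = b0"
  "dual_c 0 b0 1 (1 - b0) = 1" "dual_d 0 b0 1 (1 - b0) = 1 - b0"
  by (simp_all add: dual_a_def dual_b_def dual_c_def dual_d_def field_simps)

text \<open>The left-hand sides keep the unsimplified shape that arises on unfolding
  \<open>AW_series\<close> and \<open>AW_domain\<close>, so that they can be used by
  \<open>unfolding\<close>; the right-hand sides are the parameters of
  \<open>special_W87\<close>.\<close>

lemma qpow_args:
  "qpow \<tau> (2 + 0 - (1 - b0) + \<mu> + x) = - q * qpow \<tau> \<mu> * qpow \<tau> x"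
  "qpow \<tau> (2 + 0 - (1 - b0) + \<mu> - x) = - q * qpow \<tau> \<mu> / qpow \<tau> x"
  "qpow \<tau> (2 - 0 - (1 - b0)) = - q"
  "qpow \<tau> (2 + 0 - (1 - b0)) = - q"
  "qpow \<tau> (0 + b0 + 1 + \<mu>) = - q * qpow \<tau> \<mu>"
  "qpow \<tau> (2 - (1 - b0) + x) = - q * qpow \<tau> x"
  "qpow \<tau> (2 - (1 - b0) - x) = - q / qpow \<tau> x"
  "qpow \<tau> (- 2 + 0 + b0 + 1 + \<mu>) = - qpow \<tau> \<mu> / q"
  "qpow \<tau> (0 + x) = qpow \<tau> x"
  "qpow \<tau> (0 - x) = 1 / qpow \<tau> x"
  "qpow \<tau> (b0 + \<mu>) = - qpow \<tau> \<mu>"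
  "qpow \<tau> (1 + \<mu>) = q * qpow \<tau> \<mu>"
  using qpow_half_period[OF tau_nonzero]
  by (simp_all add: qpow_add qpow_diff qpow_minus qpow_2_eq power2_eq_square q_nonzero q_def[symmetric])

text \<open>The products \<open>K\<close> in the prefactor are exactly those that make the series
  holomorphic in \<open>X\<close>, so they cancel. Every other divisor is nonzero on the domain: the
  denominator of the prefactor gives \<open>A\<close> and \<open>T\<close>, regularity gives
  \<open>u\<close>, and the second half of \<open>t\<close> is nonzero because
  \<open>|q / m| < 1\<close>.\<close>

lemma AW_series_eq_theta_quotient:
  assumes "(\<mu>, x) \<in> AW_domain \<tau> 0 b0 1 (1 - b0)"
  shows "AW_series \<tau> 0 b0 1 (1 - b0) (\<mu>, x) = numerator (\<mu>, x) / denominator (\<mu>, x)"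
proof -
  define m where "m = qpow \<tau> \<mu>"
  define X where "X = qpow \<tau> x"
  note args = qpow_args m_def[symmetric] X_def[symmetric]
  have X0: "X \<noteq> 0" by (simp add: X_def)
  have dom: "norm (- q / m) < 1"
    "qpoch_inf [- q * m, - q * m, - q * X, - q / X] (q\<^sup>2) \<noteq> 0"
    and reg: "W87_regular (- m / q) X (1 / X) m (- m) (q * m) (q\<^sup>2)"
    using assms unfolding AW_domain_def mem_Collect_eq prod.case Let_def dual_params args qpow_2_eq
    by blast+
  have "m \<noteq> 0" by (simp add: m_def)
  then have "norm q < norm m"
    using dom(1) by (simp add: norm_divide divide_less_eq)
  then interpret special_W87 q m
    by unfold_locales (use q_nonzero norm_q in auto)
  define A where "A = qprod_inf (- q * m) (q\<^sup>2)"
  define L where "L = qprod_inf (- q) (q\<^sup>2)"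
  define K where "K = qprod_inf (- q * m * X) (q\<^sup>2) * qprod_inf (- q * m / X) (q\<^sup>2)"
  define T where "T = theta_mult q X"
  define t where "t = theta_mult q m"
  define W where "W = W87 (- m / q) X (1 / X) m (- m) (q * m) (q\<^sup>2) (- q / m)"
  define S where "S = theta_mult q (m * X) + theta_mult q (m / X)"
  define u where "u = 1 + m / q"
  have nz: "A \<noteq> 0" "T \<noteq> 0" "K \<noteq> 0" "u \<noteq> 0"
    using dom(2) W87_eq(2-4)[OF X0 reg]
    by (auto simp: qpoch_inf_simps A_def T_def K_def u_def theta_mult_def)
  have "t \<noteq> 0"
    using nz(1) qprod_inf_nonzero[OF p1 dom(1)] by (simp add: t_def theta_mult_def A_def)
  have WK: "W * (u * K) = total X"
    using W87_eq(1)[OF X0 reg] by (simp only: W_def u_def K_def)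
  have tot: "2 * t * total X = u * A\<^sup>2 * S"
    using total_eq[OF X0] by (simp only: t_def u_def A_def S_def)
  have "2 * t * W * K = A\<^sup>2 * S"
  proof -
    have "u * (2 * t * W * K) = u * (A\<^sup>2 * S)"
      using tot unfolding WK[symmetric] by (simp only: mult_ac)
    then show ?thesis by (rule mult_left_cancel[OF nz(4), THEN iffD1])
  qed
  then have W: "W = A\<^sup>2 * S / (2 * t * K)"
    using nz \<open>t \<noteq> 0\<close> by (simp add: field_simps)
  have "AW_series \<tau> 0 b0 1 (1 - b0) (\<mu>, x) = K * L * L / (A * A * T) * W"
    unfolding AW_series_def Let_def dual_params prod.case args qpow_2_eq qpoch_inf_simps
    by (simp add: A_def L_def K_def T_def W_def theta_mult_def mult_ac)
  also have "\<dots> = L * L / 2 * (S / (t * T))"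
    unfolding W using nz \<open>t \<noteq> 0\<close> by (simp add: field_simps power2_eq_square)
  also have "\<dots> = numerator (\<mu>, x) / denominator (\<mu>, x)"
    by (simp add: vtheta_eq qpow_add qpow_diff qpoch_inf_simps qpow_2_eq q_def[symmetric]
        L_def S_def t_def T_def m_def X_def)
  finally show ?thesis .
qed

text \<open>The inequalities push the parameters of the infinite products and the lower parameters
  depending on \<open>X\<close> into the unit disc, where no product vanishes. At the origin
  \<open>m = X = 1\<close>, and all of them follow from \<open>|q| < 1\<close>. An open set of this
  kind is what makes the continuation unique.\<close>

lemma AW_domain_nonempty_interior:
  obtains V where "open V" "V \<noteq> {}" "V \<subseteq> AW_domain \<tau> 0 b0 1 (1 - b0)"
proof
  define V where "V = {(\<mu>, x). norm q < norm (qpow \<tau> \<mu>) \<and> norm (q * qpow \<tau> \<mu>) < 1 \<and>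
    norm (q * qpow \<tau> x) < 1 \<and> norm (q / qpow \<tau> x) < 1 \<and>
    norm (q * qpow \<tau> \<mu> * qpow \<tau> x) < 1 \<and> norm (q * qpow \<tau> \<mu> / qpow \<tau> x) < 1}"
  show "open V"
    unfolding V_def case_prod_beta qpow_def
    by (intro open_Collect_conj open_Collect_less continuous_intros) auto
  have "(0, 0) \<in> V"
    using norm_q by (simp add: V_def)
  then show "V \<noteq> {}" by blast
  show "V \<subseteq> AW_domain \<tau> 0 b0 1 (1 - b0)"
  proof safe
    fix \<mu> x assume "(\<mu>, x) \<in> V"
    define m where "m = qpow \<tau> \<mu>"
    define X where "X = qpow \<tau> x"
    note args = qpow_args m_def[symmetric] X_def[symmetric]
    have V: "norm q < norm m" "norm (q * m) < 1" "norm (q * X) < 1" "norm (q / X) < 1"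
      "norm (q * m * X) < 1" "norm (q * m / X) < 1"
      using \<open>(\<mu>, x) \<in> V\<close> by (auto simp: V_def m_def X_def)
    interpret special_W87 q m
      by unfold_locales (use q_nonzero norm_q V(1) in auto)
    have "norm (- q / m) < 1"
      using V(1) m0 by (simp add: norm_divide divide_less_eq)
    moreover have "qpoch_inf [- q * m, - q * m, - q * X, - q / X] (q\<^sup>2) \<noteq> 0"
      using V qprod_inf_nonzero[OF p1] by (simp add: qpoch_inf_simps)
    moreover have "W87_regular (- m / q) X (1 / X) m (- m) (q * m) (q\<^sup>2)"
    proof -
      have large: "norm (- m / q) > 1"
        using V(1) q0 by (simp add: norm_divide)
      have "- m / q \<noteq> 1"
      proof
        assume "- m / q = 1"
        from large show False unfolding \<open>- m / q = 1\<close> by simp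
      qed
      moreover have "qprod (- q * m / X) p k \<noteq> 0" "qprod (- q * m * X) p k \<noteq> 0" for k
        using V by (intro qprod_nonzero p1; simp)+
      ultimately show ?thesis
        using den_nonzero unfolding W87_regular_def W87_lower_params qpoch_eq by (simp add: den_def)
    qed
    ultimately show "(\<mu>, x) \<in> AW_domain \<tau> 0 b0 1 (1 - b0)"
      unfolding AW_domain_def Let_def dual_params args qpow_2_eq mem_Collect_eq prod.case by blast
  qed
qed

end

theorem proposition5p1:
  fixes \<tau> :: complex
  assumes "Re \<tau> = 0" and "Im \<tau> > 0"
  shows "meromorphic2_eq
    (askey_wilson \<tau> 0 (1 / (2 * \<tau>)) 1 (1 - 1 / (2 * \<tau>)))
    (\<lambda>(\<mu>, x). qpoch_inf [- qpow \<tau> 1, - qpow \<tau> 1] (qpow \<tau> 2) / 2 *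
       ((vtheta \<tau> (\<mu> + x) + vtheta \<tau> (\<mu> - x)) / (vtheta \<tau> \<mu> * vtheta \<tau> x)))"
proof -
  interpret self_dual_parameters \<tau> by unfold_locales (fact assms)
  let ?U = "AW_domain \<tau> 0 (1 / (2 * \<tau>)) 1 (1 - 1 / (2 * \<tau>))"
  let ?S = "AW_series \<tau> 0 (1 / (2 * \<tau>)) 1 (1 - 1 / (2 * \<tau>))"
  define G where "G = (\<lambda>z. numerator z / denominator z)"
  define F where "F = askey_wilson \<tau> 0 (1 / (2 * \<tau>)) 1 (1 - 1 / (2 * \<tau>))"
  \<comment> \<open>The theta quotient is itself a continuation of the series. This proves that a
    continuation exists, so the choice in \<open>askey_wilson\<close> also yields one, which agrees
    with \<open>G\<close> on the domain.\<close>
  have G: "meromorphic2_continuation ?S ?U G"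
    unfolding meromorphic2_continuation_def
  proof
    show "meromorphic2 G"
      unfolding G_def by (rule meromorphic2_theta_quotient)
    show "\<forall>z\<in>?U. G z = ?S z"
      using AW_series_eq_theta_quotient by (auto simp: G_def)
  qed
  then have F: "meromorphic2_continuation ?S ?U F"
    unfolding F_def askey_wilson_def by (rule someI[of "meromorphic2_continuation ?S ?U"])
  obtain V where V: "open V" "V \<noteq> {}" "V \<subseteq> ?U"
    by (rule AW_domain_nonempty_interior)
  have "meromorphic2_eq F G"
  proof (rule meromorphic2_eqI[OF _ _ V(1,2)])
    show "F z = G z" if "z \<in> V" for z
      using F G subsetD[OF V(3) that] by (simp add: meromorphic2_continuation_def)
  qed (use F G in \<open>simp_all add: meromorphic2_continuation_def\<close>)
  moreover have "G = (\<lambda>(\<mu>, x). qpoch_inf [- qpow \<tau> 1, - qpow \<tau> 1] (qpow \<tau> 2) / 2 *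
       ((vtheta \<tau> (\<mu> + x) + vtheta \<tau> (\<mu> - x)) / (vtheta \<tau> \<mu> * vtheta \<tau> x)))"
    by (auto simp: G_def)
  ultimately show ?thesis
    by (simp only: F_def)
qed

end
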